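(* Consider the equation $\frac{d}{dt}f=\mathcal{T}(f)+\frac1\varepsilon\mathcal{Q}(f)$, where $\mathcal T,\mathcal Q$ satisfy the structural positivity assumptions (P1)-(P4) listed in the context, and the scheme with correction $$f^{(i)} = f^n + \Delta t\sum_{j=1}^{i-1}\tilde a_{ij}\mathcal T(f^{(j)}) + \Delta t\sum_{j=1}^i a_{ij}\tfrac1\varepsilon\mathcal Q(f^{(j)}),\quad i=1,\dots,\nu,$$ $$\tilde f^{n+1} = f^n + \Delta t\sum_{i=1}^\nu \tilde w_i\mathcal T(f^{(i)}) + \Delta t\sum_{i=1}^\nu w_i\tfrac1\varepsilon\mathcal Q(f^{(i)}),\qquad f^{n+1}=\tilde f^{n+1}-\alpha\Delta t^2\tfrac1{\varepsilon^2}\mathcal Q'(f^* )\mathcal Q(f^{n+1}).$$ Suppose that the scheme is globally stiffly accurate, that it is either of type A and satisfies the type A positivity conditions, or of type ARS and satisfies the type ARS positivity conditions, that $\alpha\ge0$, and that $$\sum_{i}\tilde w_i=\sum_{i} w_i=1,\qquad \sum_{i}\tilde w_i\tilde c_i=\sum_{i}\tilde w_ic_i=\sum_{i} w_i\tilde c_i=\sum_{i} w_ic_i-\alpha=\frac12,$$ $$\sum_{i,j}\tilde w_i\tilde a_{ij}\tilde c_j=\sum_{i,j}\tilde w_i\tilde a_{ij}c_j=\sum_{i,j}\tilde w_ia_{ij}\tilde c_j=\sum_{i,j}\tilde w_ia_{ij}c_j=\sum_{i,j}w_i\tilde a_{ij}\tilde c_j=\sum_{i,j}w_i\tilde a_{ij}c_j=\sum_{i,j}w_ia_{ij}\tilde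 c_j-\alpha=\sum_{i,j}w_ia_{ij}c_j-\alpha=\frac16,$$ together with: (a) if $f^*=f^n$: $$\sum_i\tilde w_i\tilde c_i^2=\sum_i\tilde w_i\tilde c_ic_i=\sum_i\tilde w_ic_i^2=\sum_iw_i\tilde c_i^2=\sum_iw_i\tilde c_ic_i=\sum_iw_ic_i^2=\frac13;$$ (b) if $f^*=\tilde f^{n+1}$ or $f^*=f^{n+1}$: $$\sum_i\tilde w_i\tilde c_i^2=\sum_i\tilde w_i\tilde c_ic_i=\sum_i\tilde w_ic_i^2=\sum_iw_i\tilde c_i^2=\sum_iw_i\tilde c_ic_i-\alpha=\sum_iw_ic_i^2-2\alpha=\frac13.$$ Then the scheme is third-order accurate in the regime $\varepsilon=O(1)$, and it is positivity-preserving: if $f^n\ge0$ and $\Delta t\le c_{\mathrm{sch}}\,\mathcal C$, then $f^{n+1}\ge0$.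
   Context: **Setting.** $f=f(t)$ takes values in a space of real-valued functions, $f\ge 0$ meaning pointwise nonnegativity; $\mathcal T,\mathcal Q$ are possibly nonlinear operators on it, $\varepsilon>0$, $\Delta t>0$. $\mathcal Q'(g)f=\lim_{\delta\to0}\frac{\mathcal Q(g+\delta f)-\mathcal Q(g)}{\delta}$ is the Fréchet derivative. The stage values and $f^{n+1}$ are understood to be solutions of the (implicit) relations of the scheme. **Structural positivity assumptions.** There is a constant $\mathcal C>0$ (the CFL constraint of the forward Euler step) such that: (P1) $f\ge0$ implies $f+a\Delta t\,\mathcal T(f)\ge0$ for every constant $a$ with $0\le a\Delta t\le\mathcal C$; (P2) if $g\ge0$, $b\ge 0$ is a constant and $f-b\mathcal Q(f)=g$, then $f\ge0$; (P3) if $g,h\ge0$, $b\ge0$ is a constant and $f+b\mathcal Q'(g)\mathcal Q(f)=h$, then $f\ge0$; (P4) if $h\ge0$, $b\ge0$ is a constant and $f+b\mathcal Q'(f)\mathcal Q(f)=h$, then $f\ge0$. **Coefficients.** $\tilde A=(\tilde a_{ij})$ and $A=(a_{ij})$ are real $\nu\times\nu$ matrices with $\tilde a_{ij}=0$ for $j\ge i$ and $a_{ij}=0$ for $j>i$; $\tilde w_i,w_i$ are real; $\tilde c_i=\sum_{j=1}^{i-1}\tilde a_{ij}$, $c_i=\sum_{j=1}^{i}a_{ij}$. All sums run over $1,\dots,\nu$. - Globally stiffly accurate (GSA): $a_{\nu i}=w_i$ and $\tilde a_{\nu i}=\tilde w_i$ for all $i$ (so $\tilde f^{n+1}=f^{(\nu)}$).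 - Type A: $A$ is invertible. - Type ARS: the first row and first column of $A$ vanish, the submatrix $(a_{ij})_{i,j=2}^{\nu}$ is invertible, and $w_1=0$ (so $f^{(1)}=f^n$). **Type A positivity conditions.** Put, for $1\le j<i\le \nu$, recursively $$b_{ii}=\frac1{a_{ii}},\quad b_{ij}=-\frac1{a_{ii}}\sum_{l=j}^{i-1}a_{il}b_{lj},\quad \tilde b_{ij}=\frac1{a_{ii}}\Big(-\tilde a_{ij}-\sum_{l=j+1}^{i-1}a_{il}\tilde b_{lj}\Big),$$ $$c_{i0}=1-\sum_{j=1}^{i-1}\sum_{l=j}^{i-1}a_{il}b_{lj},\quad c_{ij}=\sum_{l=j}^{i-1}a_{il}b_{lj},\quad \tilde c_{ij}=\tilde a_{ij}+\sum_{l=j+1}^{i-1}a_{il}\tilde b_{lj}.$$ The conditions are: $a_{ii}>0$, $c_{i0}\ge0$ for $i=1,\dots,\nu$; $c_{ij}\ge0$, $\tilde c_{ij}\ge0$ for $i=2,\dots,\nu$, $j=1,\dots,i-1$. In this case $c_{\mathrm{sch}}=\min_{2\le i\le\nu,\,1\le j\le i-1}\{c_{ij}/\tilde c_{ij}\}$. **Type ARS positivity conditions.** With $b_{ij}$ ($2\le j\le i$) and $\tilde b_{ij}$ ($1\le j<i$, $i\ge2$) given by the same formulas for $i=2,\dots,\nu$, put $$c_{i0}=1-\sum_{j=2}^{i-1}\sum_{l=j}^{i-1}a_{il}b_{lj},\quad \tilde c_{i0}=\tilde a_{i1}+\sum_{j=2}^{i-1}a_{ij}\tilde b_{j1},\quad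 c_{ij}=\sum_{l=j}^{i-1}a_{il}b_{lj},\quad \tilde c_{ij}=\tilde a_{ij}+\sum_{l=j+1}^{i-1}a_{il}\tilde b_{lj}.$$ The conditions are: $a_{ii}>0$, $c_{i0}\ge0$, $\tilde c_{i0}\ge0$ for $i=2,\dots,\nu$; $c_{ij}\ge0$, $\tilde c_{ij}\ge0$ for $i=3,\dots,\nu$, $j=2,\dots,i-1$. In this case $c_{\mathrm{sch}}=\min\big\{\min_{2\le i\le\nu}c_{i0}/\tilde c_{i0},\ \min_{3\le i\le\nu,\,2\le j\le i-1}c_{ij}/\tilde c_{ij}\big\}$. In both definitions of $c_{\mathrm{sch}}$ a ratio with zero denominator is read as $+\infty$. **Accuracy.** Third-order accurate in the regime $\varepsilon=O(1)$ means: with $\varepsilon$ fixed (say $\varepsilon=1$) and $f^n$ equal to the exact solution at $t^n$, one has $f^{n+1}=f_{\mathrm{exact}}(t^n+\Delta t)+O(\Delta t^4)$ as $\Delta t\to0$. Here $\mathcal T,\mathcal Q$ are taken smooth enough for the Taylor expansions involved, and $f^{(i)},f^{n+1}=f^n+O(\Delta t)$. *)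

theory Defs
  imports
    "HOL-Analysis.Analysis"
    "HOL-Library.Landau_Symbols"
    "Jordan_Normal_Form.Matrix"
begin

text \<open>
  The space of real-valued functions is a real normed space \<open>'v\<close> with an evaluation map
  \<open>ev :: 'v \<Rightarrow> 'x \<Rightarrow> real\<close>. The norm gives the limits and the \<open>O(\<Delta>t^k)\<close> terms a meaning; it is
  not required to be related to pointwise evaluation.
\<close>

definition function_space :: "('v::real_normed_vector \<Rightarrow> 'x \<Rightarrow> real) \<Rightarrow> bool" where
  "function_space ev \<longleftrightarrow> (\<forall>x. linear (\<lambda>f. ev f x)) \<and> inj ev"

definition nonneg :: "('v \<Rightarrow> 'x \<Rightarrow> real) \<Rightarrow> 'v \<Rightarrow> bool" where
  "nonneg ev f \<longleftrightarrow> (\<forall>x. 0 \<le> ev f x)"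

definition is_derivative_of ::
  "('v::real_normed_vector \<Rightarrow> 'v \<Rightarrow> 'v) \<Rightarrow> ('v \<Rightarrow> 'v) \<Rightarrow> bool" where
  "is_derivative_of Q' Q \<longleftrightarrow>
    (\<forall>g f. ((\<lambda>\<delta>::real. (1 / \<delta>) *\<^sub>R (Q (g + \<delta> *\<^sub>R f) - Q g)) \<longlongrightarrow> Q' g f) (at 0))"

text \<open>Structural positivity assumptions; \<open>C\<close> is the CFL constant of the forward Euler step.\<close>

definition P1 :: "('v::real_normed_vector \<Rightarrow> 'x \<Rightarrow> real) \<Rightarrow> ('v \<Rightarrow> 'v) \<Rightarrow> real \<Rightarrow> bool" where
  "P1 ev T C \<longleftrightarrow>
    (\<forall>f a dt. nonneg ev f \<longrightarrow> 0 < dt \<longrightarrow> 0 \<le> a * dt \<longrightarrow> a * dt \<le> C \<longrightarrow>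
      nonneg ev (f + (a * dt) *\<^sub>R T f))"

definition P2 :: "('v::real_normed_vector \<Rightarrow> 'x \<Rightarrow> real) \<Rightarrow> ('v \<Rightarrow> 'v) \<Rightarrow> bool" where
  "P2 ev Q \<longleftrightarrow>
    (\<forall>f g b. nonneg ev g \<longrightarrow> 0 \<le> b \<longrightarrow> f - b *\<^sub>R Q f = g \<longrightarrow> nonneg ev f)"

definition P3 :: "('v::real_normed_vector \<Rightarrow> 'x \<Rightarrow> real) \<Rightarrow> ('v \<Rightarrow> 'v) \<Rightarrow> ('v \<Rightarrow> 'v \<Rightarrow> 'v) \<Rightarrow> bool" where
  "P3 ev Q Q' \<longleftrightarrow>
    (\<forall>f g h b. nonneg ev g \<longrightarrow> nonneg ev h \<longrightarrow> 0 \<le> b \<longrightarrow> f + b *\<^sub>R Q' g (Q f) = h \<longrightarrow>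
      nonneg ev f)"

definition P4 :: "('v::real_normed_vector \<Rightarrow> 'x \<Rightarrow> real) \<Rightarrow> ('v \<Rightarrow> 'v) \<Rightarrow> ('v \<Rightarrow> 'v \<Rightarrow> 'v) \<Rightarrow> bool" where
  "P4 ev Q Q' \<longleftrightarrow>
    (\<forall>f h b. nonneg ev h \<longrightarrow> 0 \<le> b \<longrightarrow> f + b *\<^sub>R Q' f (Q f) = h \<longrightarrow> nonneg ev f)"

text \<open>
  Coefficients: \<open>ta\<close>, \<open>tw\<close> are the explicit (tilde) ones, \<open>a\<close>, \<open>w\<close> the implicit ones.
  All indices run over \<open>{1..\<nu>}\<close>; values outside this range are irrelevant.
\<close>

definition imex_triangular ::
  "nat \<Rightarrow> (nat \<Rightarrow> nat \<Rightarrow> real) \<Rightarrow> (nat \<Rightarrow> nat \<Rightarrow> real) \<Rightarrow> bool" where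
  "imex_triangular \<nu> ta a \<longleftrightarrow>
    (\<forall>i\<in>{1..\<nu>}. \<forall>j\<in>{1..\<nu>}. (j \<ge> i \<longrightarrow> ta i j = 0) \<and> (j > i \<longrightarrow> a i j = 0))"

definition ex_abscissa :: "(nat \<Rightarrow> nat \<Rightarrow> real) \<Rightarrow> nat \<Rightarrow> real" where
  "ex_abscissa ta i = (\<Sum>j=1..<i. ta i j)"

definition im_abscissa :: "(nat \<Rightarrow> nat \<Rightarrow> real) \<Rightarrow> nat \<Rightarrow> real" where
  "im_abscissa a i = (\<Sum>j=1..i. a i j)"

definition GSA ::
  "nat \<Rightarrow> (nat \<Rightarrow> nat \<Rightarrow> real) \<Rightarrow> (nat \<Rightarrow> nat \<Rightarrow> real) \<Rightarrow> (nat \<Rightarrow> real) \<Rightarrow> (nat \<Rightarrow> real) \<Rightarrow> bool" where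
  "GSA \<nu> ta a tw w \<longleftrightarrow> (\<forall>i\<in>{1..\<nu>}. a \<nu> i = w i \<and> ta \<nu> i = tw i)"

text \<open>The index shifts convert to the 0-based matrices of the library.\<close>

definition type_A :: "nat \<Rightarrow> (nat \<Rightarrow> nat \<Rightarrow> real) \<Rightarrow> bool" where
  "type_A \<nu> a \<longleftrightarrow> invertible_mat (Matrix.mat \<nu> \<nu> (\<lambda>(i, j). a (i + 1) (j + 1)))"

definition type_ARS :: "nat \<Rightarrow> (nat \<Rightarrow> nat \<Rightarrow> real) \<Rightarrow> (nat \<Rightarrow> real) \<Rightarrow> bool" where
  "type_ARS \<nu> a w \<longleftrightarrow>
    (\<forall>i\<in>{1..\<nu>}. a 1 i = 0 \<and> a i 1 = 0) \<and>
    invertible_mat (Matrix.mat (\<nu> - 1) (\<nu> - 1) (\<lambda>(i, j). a (i + 2) (j + 2))) \<and>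
    w 1 = 0"

function b_coef :: "(nat \<Rightarrow> nat \<Rightarrow> real) \<Rightarrow> nat \<Rightarrow> nat \<Rightarrow> real" where
  "b_coef a i j =
    (if j = i then 1 / a i i
     else if j < i then - (1 / a i i) * (\<Sum>l=j..<i. a i l * b_coef a l j)
     else 0)"
  by pat_completeness auto
termination by (relation "Wellfounded.measure (\<lambda>(a, i, j). i)") auto

function tb_coef ::
  "(nat \<Rightarrow> nat \<Rightarrow> real) \<Rightarrow> (nat \<Rightarrow> nat \<Rightarrow> real) \<Rightarrow> nat \<Rightarrow> nat \<Rightarrow> real" where
  "tb_coef ta a i j =
    (if j < i then (1 / a i i) * (- ta i j - (\<Sum>l=j+1..<i. a i l * tb_coef ta a l j))
     else 0)"
  by pat_completeness auto
termination by (relation "Wellfounded.measure (\<lambda>(ta, a, i, j). i)") auto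

declare b_coef.simps [simp del] tb_coef.simps [simp del]

definition c_coef :: "(nat \<Rightarrow> nat \<Rightarrow> real) \<Rightarrow> nat \<Rightarrow> nat \<Rightarrow> real" where
  "c_coef a i j = (\<Sum>l=j..<i. a i l * b_coef a l j)"

definition tc_coef ::
  "(nat \<Rightarrow> nat \<Rightarrow> real) \<Rightarrow> (nat \<Rightarrow> nat \<Rightarrow> real) \<Rightarrow> nat \<Rightarrow> nat \<Rightarrow> real" where
  "tc_coef ta a i j = ta i j + (\<Sum>l=j+1..<i. a i l * tb_coef ta a l j)"

definition c0_A :: "(nat \<Rightarrow> nat \<Rightarrow> real) \<Rightarrow> nat \<Rightarrow> real" where
  "c0_A a i = 1 - (\<Sum>j=1..<i. \<Sum>l=j..<i. a i l * b_coef a l j)"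

definition c0_ARS :: "(nat \<Rightarrow> nat \<Rightarrow> real) \<Rightarrow> nat \<Rightarrow> real" where
  "c0_ARS a i = 1 - (\<Sum>j=2..<i. \<Sum>l=j..<i. a i l * b_coef a l j)"

definition tc0_ARS :: "(nat \<Rightarrow> nat \<Rightarrow> real) \<Rightarrow> (nat \<Rightarrow> nat \<Rightarrow> real) \<Rightarrow> nat \<Rightarrow> real" where
  "tc0_ARS ta a i = ta i 1 + (\<Sum>j=2..<i. a i j * tb_coef ta a j 1)"

definition positivity_conditions_A ::
  "nat \<Rightarrow> (nat \<Rightarrow> nat \<Rightarrow> real) \<Rightarrow> (nat \<Rightarrow> nat \<Rightarrow> real) \<Rightarrow> bool" where
  "positivity_conditions_A \<nu> ta a \<longleftrightarrow>
    (\<forall>i\<in>{1..\<nu>}. a i i > 0 \<and> c0_A a i \<ge> 0) \<and>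
    (\<forall>i\<in>{2..\<nu>}. \<forall>j\<in>{1..i-1}. c_coef a i j \<ge> 0 \<and> tc_coef ta a i j \<ge> 0)"

definition positivity_conditions_ARS ::
  "nat \<Rightarrow> (nat \<Rightarrow> nat \<Rightarrow> real) \<Rightarrow> (nat \<Rightarrow> nat \<Rightarrow> real) \<Rightarrow> bool" where
  "positivity_conditions_ARS \<nu> ta a \<longleftrightarrow>
    (\<forall>i\<in>{2..\<nu>}. a i i > 0 \<and> c0_ARS a i \<ge> 0 \<and> tc0_ARS ta a i \<ge> 0) \<and>
    (\<forall>i\<in>{3..\<nu>}. \<forall>j\<in>{2..i-1}. c_coef a i j \<ge> 0 \<and> tc_coef ta a i j \<ge> 0)"

text \<open>
  The minima are infima in \<open>ereal\<close>, so that a minimum over an empty index set is \<open>\<infinity>\<close>.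
\<close>

definition ratio :: "real \<Rightarrow> real \<Rightarrow> ereal" where
  "ratio p q = (if q = 0 then \<infinity> else ereal (p / q))"

definition c_sch_A :: "nat \<Rightarrow> (nat \<Rightarrow> nat \<Rightarrow> real) \<Rightarrow> (nat \<Rightarrow> nat \<Rightarrow> real) \<Rightarrow> ereal" where
  "c_sch_A \<nu> ta a = (INF i\<in>{2..\<nu>}. INF j\<in>{1..i-1}. ratio (c_coef a i j) (tc_coef ta a i j))"

definition c_sch_ARS :: "nat \<Rightarrow> (nat \<Rightarrow> nat \<Rightarrow> real) \<Rightarrow> (nat \<Rightarrow> nat \<Rightarrow> real) \<Rightarrow> ereal" where
  "c_sch_ARS \<nu> ta a =
    min (INF i\<in>{2..\<nu>}. ratio (c0_ARS a i) (tc0_ARS ta a i))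
        (INF i\<in>{3..\<nu>}. INF j\<in>{2..i-1}. ratio (c_coef a i j) (tc_coef ta a i j))"

text \<open>The three choices (old value, uncorrected value, new value) for the point \<open>f\<^sup>*\<close> of the correction term.\<close>

datatype star = Star_Old | Star_Tilde | Star_New

fun star_value :: "star \<Rightarrow> 'v \<Rightarrow> 'v \<Rightarrow> 'v \<Rightarrow> 'v" where
  "star_value Star_Old fn ft f1 = fn"
| "star_value Star_Tilde fn ft f1 = ft"
| "star_value Star_New fn ft f1 = f1"

text \<open>
  \<open>st i\<close>, \<open>ft\<close> and \<open>f1\<close> stand for \<open>f\<^sup>(\<^sup>i\<^sup>)\<close>, the uncorrected value and \<open>f\<^sup>n\<^sup>+\<^sup>1\<close>: the implicit
  relations are a predicate on them, so neither existence nor uniqueness is built in.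
\<close>

definition imex_step ::
  "('v::real_normed_vector \<Rightarrow> 'v) \<Rightarrow> ('v \<Rightarrow> 'v) \<Rightarrow> ('v \<Rightarrow> 'v \<Rightarrow> 'v) \<Rightarrow>
   nat \<Rightarrow> (nat \<Rightarrow> nat \<Rightarrow> real) \<Rightarrow> (nat \<Rightarrow> nat \<Rightarrow> real) \<Rightarrow> (nat \<Rightarrow> real) \<Rightarrow> (nat \<Rightarrow> real) \<Rightarrow> real \<Rightarrow>
   star \<Rightarrow> real \<Rightarrow> real \<Rightarrow> 'v \<Rightarrow> (nat \<Rightarrow> 'v) \<Rightarrow> 'v \<Rightarrow> 'v \<Rightarrow> bool" where
  "imex_step T Q Q' \<nu> ta a tw w \<alpha> s \<epsilon> dt fn st ft f1 \<longleftrightarrow>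
    (\<forall>i\<in>{1..\<nu>}. st i =
       fn + dt *\<^sub>R (\<Sum>j=1..<i. ta i j *\<^sub>R T (st j))
          + dt *\<^sub>R (\<Sum>j=1..i. a i j *\<^sub>R (1 / \<epsilon>) *\<^sub>R Q (st j))) \<and>
    ft = fn + dt *\<^sub>R (\<Sum>i=1..\<nu>. tw i *\<^sub>R T (st i))
            + dt *\<^sub>R (\<Sum>i=1..\<nu>. w i *\<^sub>R (1 / \<epsilon>) *\<^sub>R Q (st i)) \<and>
    f1 = ft - (\<alpha> * dt ^ 2 * (1 / \<epsilon> ^ 2)) *\<^sub>R Q' (star_value s fn ft f1) (Q f1)"

definition order_conditions ::
  "nat \<Rightarrow> (nat \<Rightarrow> nat \<Rightarrow> real) \<Rightarrow> (nat \<Rightarrow> nat \<Rightarrow> real) \<Rightarrow> (nat \<Rightarrow> real) \<Rightarrow> (nat \<Rightarrow> real) \<Rightarrow> real \<Rightarrow> bool" where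
  "order_conditions \<nu> ta a tw w \<alpha> \<longleftrightarrow>
    (let tc = ex_abscissa ta; c = im_abscissa a in
      (\<Sum>i=1..\<nu>. tw i) = 1 \<and>
      (\<Sum>i=1..\<nu>. w i) = 1 \<and>
      (\<Sum>i=1..\<nu>. tw i * tc i) = 1/2 \<and>
      (\<Sum>i=1..\<nu>. tw i * c i) = 1/2 \<and>
      (\<Sum>i=1..\<nu>. w i * tc i) = 1/2 \<and>
      (\<Sum>i=1..\<nu>. w i * c i) - \<alpha> = 1/2 \<and>
      (\<Sum>i=1..\<nu>. \<Sum>j=1..\<nu>. tw i * ta i j * tc j) = 1/6 \<and>
      (\<Sum>i=1..\<nu>. \<Sum>j=1..\<nu>. tw i * ta i j * c j) = 1/6 \<and>
      (\<Sum>i=1..\<nu>. \<Sum>j=1..\<nu>. tw i * a i j * tc j) = 1/6 \<and>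
      (\<Sum>i=1..\<nu>. \<Sum>j=1..\<nu>. tw i * a i j * c j) = 1/6 \<and>
      (\<Sum>i=1..\<nu>. \<Sum>j=1..\<nu>. w i * ta i j * tc j) = 1/6 \<and>
      (\<Sum>i=1..\<nu>. \<Sum>j=1..\<nu>. w i * ta i j * c j) = 1/6 \<and>
      (\<Sum>i=1..\<nu>. \<Sum>j=1..\<nu>. w i * a i j * tc j) - \<alpha> = 1/6 \<and>
      (\<Sum>i=1..\<nu>. \<Sum>j=1..\<nu>. w i * a i j * c j) - \<alpha> = 1/6)"

definition order_conditions_old ::
  "nat \<Rightarrow> (nat \<Rightarrow> nat \<Rightarrow> real) \<Rightarrow> (nat \<Rightarrow> nat \<Rightarrow> real) \<Rightarrow> (nat \<Rightarrow> real) \<Rightarrow> (nat \<Rightarrow> real) \<Rightarrow> bool" where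
  "order_conditions_old \<nu> ta a tw w \<longleftrightarrow>
    (let tc = ex_abscissa ta; c = im_abscissa a in
      (\<Sum>i=1..\<nu>. tw i * (tc i)^2) = 1/3 \<and>
      (\<Sum>i=1..\<nu>. tw i * tc i * c i) = 1/3 \<and>
      (\<Sum>i=1..\<nu>. tw i * (c i)^2) = 1/3 \<and>
      (\<Sum>i=1..\<nu>. w i * (tc i)^2) = 1/3 \<and>
      (\<Sum>i=1..\<nu>. w i * tc i * c i) = 1/3 \<and>
      (\<Sum>i=1..\<nu>. w i * (c i)^2) = 1/3)"

definition order_conditions_new ::
  "nat \<Rightarrow> (nat \<Rightarrow> nat \<Rightarrow> real) \<Rightarrow> (nat \<Rightarrow> nat \<Rightarrow> real) \<Rightarrow> (nat \<Rightarrow> real) \<Rightarrow> (nat \<Rightarrow> real) \<Rightarrow> real \<Rightarrow> bool" where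
  "order_conditions_new \<nu> ta a tw w \<alpha> \<longleftrightarrow>
    (let tc = ex_abscissa ta; c = im_abscissa a in
      (\<Sum>i=1..\<nu>. tw i * (tc i)^2) = 1/3 \<and>
      (\<Sum>i=1..\<nu>. tw i * tc i * c i) = 1/3 \<and>
      (\<Sum>i=1..\<nu>. tw i * (c i)^2) = 1/3 \<and>
      (\<Sum>i=1..\<nu>. w i * (tc i)^2) = 1/3 \<and>
      (\<Sum>i=1..\<nu>. w i * tc i * c i) - \<alpha> = 1/3 \<and>
      (\<Sum>i=1..\<nu>. w i * (c i)^2) - 2 * \<alpha> = 1/3)"

text \<open>Three times continuously Frechet differentiable on an open set.\<close>

definition C3_on :: "'v::real_normed_vector set \<Rightarrow> ('v \<Rightarrow> 'v) \<Rightarrow> bool" where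
  "C3_on U F \<longleftrightarrow>
    (\<exists>(D1 :: 'v \<Rightarrow> 'v \<Rightarrow>\<^sub>L 'v) (D2 :: 'v \<Rightarrow> 'v \<Rightarrow>\<^sub>L 'v \<Rightarrow>\<^sub>L 'v) (D3 :: 'v \<Rightarrow> 'v \<Rightarrow>\<^sub>L 'v \<Rightarrow>\<^sub>L 'v \<Rightarrow>\<^sub>L 'v).
      (\<forall>x\<in>U. (F has_derivative blinfun_apply (D1 x)) (at x)) \<and>
      (\<forall>x\<in>U. (D1 has_derivative blinfun_apply (D2 x)) (at x)) \<and>
      (\<forall>x\<in>U. (D2 has_derivative blinfun_apply (D3 x)) (at x)) \<and>
      continuous_on U D3)"

text \<open>
  Local error with \<open>\<epsilon>\<close> fixed: \<open>u\<close> is an exact solution on \<open>[tn, tn + h0]\<close>, one step of size \<open>dt\<close>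
  starts from \<open>u tn\<close>, and \<open>st dt i\<close>, \<open>ft dt\<close>, \<open>f1 dt\<close> solve the scheme for all small \<open>dt > 0\<close>
  and lie \<open>O(dt)\<close>-close to \<open>u tn\<close>. The operators need to be smooth only near \<open>u tn\<close>.
\<close>

definition third_order_accurate ::
  "('v::real_normed_vector \<Rightarrow> 'v) \<Rightarrow> ('v \<Rightarrow> 'v) \<Rightarrow> ('v \<Rightarrow> 'v \<Rightarrow> 'v) \<Rightarrow>
   nat \<Rightarrow> (nat \<Rightarrow> nat \<Rightarrow> real) \<Rightarrow> (nat \<Rightarrow> nat \<Rightarrow> real) \<Rightarrow> (nat \<Rightarrow> real) \<Rightarrow> (nat \<Rightarrow> real) \<Rightarrow> real \<Rightarrow>
   star \<Rightarrow> bool" where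
  "third_order_accurate T Q Q' \<nu> ta a tw w \<alpha> s \<longleftrightarrow>
    (\<forall>(\<epsilon>::real) (tn::real) (h0::real) (u :: real \<Rightarrow> 'v) (U :: 'v set)
        (st :: real \<Rightarrow> nat \<Rightarrow> 'v) (ft :: real \<Rightarrow> 'v) (f1 :: real \<Rightarrow> 'v).
      \<epsilon> > 0 \<longrightarrow> h0 > 0 \<longrightarrow>
      (\<forall>t\<in>{tn..tn+h0}.
         (u has_vector_derivative (T (u t) + (1 / \<epsilon>) *\<^sub>R Q (u t))) (at t within {tn..tn+h0})) \<longrightarrow>
      open U \<longrightarrow> u tn \<in> U \<longrightarrow> C3_on U T \<longrightarrow> C3_on U Q \<longrightarrow>
      (\<forall>\<^sub>F dt in at_right 0.
         imex_step T Q Q' \<nu> ta a tw w \<alpha> s \<epsilon> dt (u tn) (st dt) (ft dt) (f1 dt)) \<longrightarrow>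
      (\<forall>i\<in>{1..\<nu>}. (\<lambda>dt. norm (st dt i - u tn)) \<in> O[at_right 0](\<lambda>dt. dt)) \<longrightarrow>
      (\<lambda>dt. norm (f1 dt - u tn)) \<in> O[at_right 0](\<lambda>dt. dt) \<longrightarrow>
      (\<lambda>dt. norm (f1 dt - u (tn + dt))) \<in> O[at_right 0](\<lambda>dt. dt ^ 4))"

definition positivity_preserving ::
  "('v::real_normed_vector \<Rightarrow> 'x \<Rightarrow> real) \<Rightarrow> ('v \<Rightarrow> 'v) \<Rightarrow> ('v \<Rightarrow> 'v) \<Rightarrow> ('v \<Rightarrow> 'v \<Rightarrow> 'v) \<Rightarrow>
   nat \<Rightarrow> (nat \<Rightarrow> nat \<Rightarrow> real) \<Rightarrow> (nat \<Rightarrow> nat \<Rightarrow> real) \<Rightarrow> (nat \<Rightarrow> real) \<Rightarrow> (nat \<Rightarrow> real) \<Rightarrow> real \<Rightarrow>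
   star \<Rightarrow> ereal \<Rightarrow> bool" where
  "positivity_preserving ev T Q Q' \<nu> ta a tw w \<alpha> s dt_max \<longleftrightarrow>
    (\<forall>(\<epsilon>::real) (dt::real) fn st ft f1.
      \<epsilon> > 0 \<longrightarrow> dt > 0 \<longrightarrow> ereal dt \<le> dt_max \<longrightarrow>
      imex_step T Q Q' \<nu> ta a tw w \<alpha> s \<epsilon> dt fn st ft f1 \<longrightarrow>
      nonneg ev fn \<longrightarrow> nonneg ev f1)"

end

theory Submission
  imports Defs
begin

text \<open>
  Positivity. Solving the triangular stage equations for the stiff terms turns stage \<open>i\<close> into
  \<open>f\<^sup>(\<^sup>i\<^sup>) - a\<^sub>i\<^sub>i (\<Delta>t/\<epsilon>) Q(f\<^sup>(\<^sup>i\<^sup>)) = c\<^sub>i\<^sub>0 f\<^sup>n + \<Sum>\<^sub>j (c\<^sub>i\<^sub>j f\<^sup>(\<^sup>j\<^sup>) + \<Delta>t tc\<^sub>i\<^sub>j T(f\<^sup>(\<^sup>j\<^sup>)))\<close>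
  (\<open>stage_shu_osher\<close>). Each summand is \<open>c\<^sub>i\<^sub>j\<close> times a forward Euler step of size
  \<open>\<Delta>t tc\<^sub>i\<^sub>j / c\<^sub>i\<^sub>j\<close>, and \<open>c\<^sub>s\<^sub>c\<^sub>h\<close> is exactly what keeps all these sizes below the Euler limit \<open>C\<close>
  (\<open>nonneg_euler_step\<close>). So the right-hand side is nonnegative by induction over the stages, and
  (P2), the positivity of an implicit step, gives \<open>f\<^sup>(\<^sup>i\<^sup>) \<ge> 0\<close>. Type ARS differs only in that the
  first stage is \<open>f\<^sup>n\<close> itself, so the elimination starts at the second stage. Global stiff accuracy
  makes the last stage the uncorrected value, and since \<open>\<alpha> \<ge> 0\<close> the correction is an implicit
  equation of the kind treated by (P3) or, when \<open>f\<^sup>* = f\<^sup>n\<^sup>+\<^sup>1\<close>, by (P4).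

  Accuracy. Write \<open>L = Q/\<epsilon>\<close> and \<open>x0 = f\<^sup>n\<close>; derivatives are taken at \<open>x0\<close>. The exact solution and
  the numerical one are both expanded in powers of \<open>\<Delta>t\<close> up to \<open>\<Delta>t^3\<close>, with remainder
  \<open>O(\<Delta>t^4)\<close>. All expansions come from the same bootstrap: a value known up to \<open>O(\<Delta>t^k)\<close> gives
  \<open>T\<close> and \<open>L\<close> up to \<open>O(\<Delta>t^k)\<close> by Taylor's formula, and the factor \<open>\<Delta>t\<close> in the scheme, or one
  integration in time for the exact solution, raises the order by one
  (\<open>exact_solution_expansion\<close>, \<open>stage_expansions\<close>). The correction contributes
  \<open>\<alpha> \<Delta>t^2 L'L\<close> and \<open>\<alpha> \<Delta>t^3 (L'L'(T + L) + \<sigma> L''(T + L, L))\<close>, where \<open>\<sigma> = 0\<close> if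
  \<open>f\<^sup>* = f\<^sup>n\<close> and \<open>\<sigma> = 1\<close> otherwise (\<open>correction_expansion\<close>). The order conditions state that the
  coefficients of the elementary differentials then agree with those of the exact solution
  (\<open>third_order_coefficients\<close>). This last comparison identifies \<open>L''(T, L)\<close> with \<open>L''(L, T)\<close>,
  which is why the symmetry of the second Frechet derivative is proved on the way
  (\<open>C3_on_jet\<close>).
\<close>

section \<open>Positivity through the Shu-Osher form of the stages\<close>

lemma sum_swap_weakly_lower:
  fixes f :: "nat \<Rightarrow> nat \<Rightarrow> 'b::comm_monoid_add"
  shows "(\<Sum>l=m..<i. \<Sum>j=m..l. f l j) = (\<Sum>j=m..<i. \<Sum>l=j..<i. f l j)"
proof -
  have "(\<Sum>l=m..<i. \<Sum>j=m..l. f l j) = (\<Sum>l\<in>{m..<i}. \<Sum>j | j \<in> {m..<i} \<and> j \<le> l. f l j)"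
    by (intro sum.cong) auto
  also have "\<dots> = (\<Sum>j\<in>{m..<i}. \<Sum>l | l \<in> {m..<i} \<and> j \<le> l. f l j)"
    by (rule sum.swap_restrict) auto
  also have "\<dots> = (\<Sum>j=m..<i. \<Sum>l=j..<i. f l j)"
    by (intro sum.cong) auto
  finally show ?thesis .
qed

lemma sum_swap_strictly_lower:
  fixes f :: "nat \<Rightarrow> nat \<Rightarrow> 'b::comm_monoid_add"
  assumes "m \<le> 2"
  shows "(\<Sum>l=m..<i. \<Sum>j=1..<l. f l j) = (\<Sum>j=1..<i. \<Sum>l=j+1..<i. f l j)"
proof -
  have "(\<Sum>l=m..<i. \<Sum>j=1..<l. f l j) = (\<Sum>l\<in>{m..<i}. \<Sum>j | j \<in> {1..<i} \<and> j < l. f l j)"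
    by (intro sum.cong) auto
  also have "\<dots> = (\<Sum>j\<in>{1..<i}. \<Sum>l | l \<in> {m..<i} \<and> j < l. f l j)"
    by (rule sum.swap_restrict) auto
  also have "\<dots> = (\<Sum>j=1..<i. \<Sum>l=j+1..<i. f l j)"
    using assms by (intro sum.cong) auto
  finally show ?thesis .
qed

text \<open>
  One elimination step: the stiff terms of the earlier stages are replaced by their expressions in
  the stage values and the explicit terms, and exchanging the order of summation collects the
  coefficients. The case \<open>m = 1\<close> serves type A and \<open>m = 2\<close> type ARS; the strictly lower sums over
  \<open>l > j \<ge> 1\<close> run over the indices \<open>l \<ge> m\<close> in both cases, which is what \<open>m \<le> 2\<close> is for.
\<close>
lemma stage_shu_osher_aux:
  fixes y F K :: "nat \<Rightarrow> 'v::real_vector"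
  assumes "m \<le> 2"
    and y: "y i = x0 + (\<Sum>j=1..<i. ta i j *\<^sub>R K j) + (\<Sum>l=m..i. a i l *\<^sub>R F l)"
    and F: "\<And>l. l \<in> {m..<i} \<Longrightarrow>
      F l = (\<Sum>j=m..l. b_coef a l j *\<^sub>R (y j - x0)) + (\<Sum>j=1..<l. tb_coef ta a l j *\<^sub>R K j)"
    and "m \<le> i"
  shows "y i = x0 + (\<Sum>j=m..<i. c_coef a i j *\<^sub>R (y j - x0))
    + (\<Sum>j=1..<i. tc_coef ta a i j *\<^sub>R K j) + a i i *\<^sub>R F i"
proof -
  have "(\<Sum>l=m..<i. \<Sum>j=m..l. (a i l * b_coef a l j) *\<^sub>R (y j - x0))
      = (\<Sum>j=m..<i. c_coef a i j *\<^sub>R (y j - x0))"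
    by (simp only: sum_swap_weakly_lower c_coef_def scaleR_sum_left)
  moreover have "(\<Sum>l=m..<i. \<Sum>j=1..<l. (a i l * tb_coef ta a l j) *\<^sub>R K j)
      = (\<Sum>j=1..<i. tc_coef ta a i j *\<^sub>R K j) - (\<Sum>j=1..<i. ta i j *\<^sub>R K j)"
    by (simp only: sum_swap_strictly_lower[OF \<open>m \<le> 2\<close>] tc_coef_def scaleR_sum_left scaleR_add_left
        sum.distrib add_diff_cancel_left')
  ultimately have lower: "(\<Sum>l=m..<i. a i l *\<^sub>R F l) =
      (\<Sum>j=m..<i. c_coef a i j *\<^sub>R (y j - x0))
      + ((\<Sum>j=1..<i. tc_coef ta a i j *\<^sub>R K j) - (\<Sum>j=1..<i. ta i j *\<^sub>R K j))"
    by (simp add: F scaleR_sum_right scaleR_add_right sum.distrib)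
  have "{m..i} = insert i {m..<i}" using \<open>m \<le> i\<close> by auto
  then have "(\<Sum>l=m..i. a i l *\<^sub>R F l) = a i i *\<^sub>R F i + (\<Sum>l=m..<i. a i l *\<^sub>R F l)" by simp
  then show ?thesis unfolding y lower by simp
qed

text \<open>
  The recursion for \<open>b_coef\<close> inverts the triangular matrix \<open>a\<close>, and \<open>tb_coef\<close> is minus the product of
  this inverse with \<open>ta\<close>. Hence \<open>F i\<close> is the combination of the \<open>y j - x0\<close> and \<open>K j\<close> with these
  coefficients. Substituting it back below the diagonal leaves only the implicit term of stage \<open>i\<close>.
\<close>
lemma stage_shu_osher:
  fixes y F K :: "nat \<Rightarrow> 'v::real_vector"
  assumes "m \<le> 2"
    and y: "\<And>i. i \<in> {m..n} \<Longrightarrow>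
      y i = x0 + (\<Sum>j=1..<i. ta i j *\<^sub>R K j) + (\<Sum>l=m..i. a i l *\<^sub>R F l)"
    and nz: "\<And>i. i \<in> {m..n} \<Longrightarrow> a i i \<noteq> 0"
    and i: "i \<in> {m..n}"
  shows "y i = (1 - (\<Sum>j=m..<i. c_coef a i j)) *\<^sub>R x0 + (\<Sum>j=m..<i. c_coef a i j *\<^sub>R y j)
    + (\<Sum>j=1..<i. tc_coef ta a i j *\<^sub>R K j) + a i i *\<^sub>R F i"
proof -
  have F: "F i = (\<Sum>j=m..i. b_coef a i j *\<^sub>R (y j - x0)) + (\<Sum>j=1..<i. tb_coef ta a i j *\<^sub>R K j)"
    if "i \<in> {m..n}" for i
    using that
  proof (induction i rule: less_induct)
    case (less i)
    have eq: "y i = x0 + (\<Sum>j=m..<i. c_coef a i j *\<^sub>R (y j - x0))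
        + (\<Sum>j=1..<i. tc_coef ta a i j *\<^sub>R K j) + a i i *\<^sub>R F i"
      using less.prems by (intro stage_shu_osher_aux[OF \<open>m \<le> 2\<close> y less.IH]) auto
    have b: "b_coef a i j = - (1 / a i i) * c_coef a i j" if "j \<in> {m..<i}" for j
      using that by (simp add: b_coef.simps[of a i j] c_coef_def)
    have tb: "tb_coef ta a i j = - (1 / a i i) * tc_coef ta a i j" if "j \<in> {1..<i}" for j
      using that by (simp add: tb_coef.simps[of ta a i j] tc_coef_def diff_divide_distrib add_divide_distrib)
    have "{m..i} = insert i {m..<i}" using less.prems by auto
    then have "(\<Sum>j=m..i. b_coef a i j *\<^sub>R (y j - x0)) + (\<Sum>j=1..<i. tb_coef ta a i j *\<^sub>R K j)
        = (1 / a i i) *\<^sub>R ((y i - x0) - (\<Sum>j=m..<i. c_coef a i j *\<^sub>R (y j - x0))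
          - (\<Sum>j=1..<i. tc_coef ta a i j *\<^sub>R K j))"
      by (simp add: b tb b_coef.simps[of a i i] scaleR_sum_right scaleR_diff_right sum_negf sum_subtractf)
    also have "\<dots> = (1 / a i i) *\<^sub>R (a i i *\<^sub>R F i)"
      by (subst eq) simp
    finally show ?case using nz[OF less.prems] by simp
  qed
  have "y i = x0 + (\<Sum>j=m..<i. c_coef a i j *\<^sub>R (y j - x0))
      + (\<Sum>j=1..<i. tc_coef ta a i j *\<^sub>R K j) + a i i *\<^sub>R F i"
    using i by (intro stage_shu_osher_aux[OF \<open>m \<le> 2\<close> y F]) auto
  then show ?thesis
    by (simp add: scaleR_diff_right scaleR_diff_left sum_subtractf scaleR_sum_left)
qed

lemma
  assumes "function_space ev"
  shows ev_add: "ev (f + g) x = ev f x + ev g x"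
    and ev_scaleR: "ev (c *\<^sub>R f) x = c * ev f x"
    and ev_sum: "ev (sum h I) x = (\<Sum>i\<in>I. ev (h i) x)"
proof -
  have lin: "linear (\<lambda>f. ev f x)" using assms unfolding function_space_def by blast
  show "ev (f + g) x = ev f x + ev g x" by (rule linear_add[OF lin])
  show "ev (c *\<^sub>R f) x = c * ev f x" using linear_scale[OF lin] by simp
  show "ev (sum h I) x = (\<Sum>i\<in>I. ev (h i) x)" by (rule linear_sum[OF lin])
qed

lemma nonneg_add: "function_space ev \<Longrightarrow> nonneg ev f \<Longrightarrow> nonneg ev g \<Longrightarrow> nonneg ev (f + g)"
  by (simp add: nonneg_def ev_add)

lemma nonneg_scaleR: "function_space ev \<Longrightarrow> 0 \<le> c \<Longrightarrow> nonneg ev f \<Longrightarrow> nonneg ev (c *\<^sub>R f)"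
  by (simp add: nonneg_def ev_scaleR)

lemma nonneg_sum:
  "function_space ev \<Longrightarrow> (\<And>i. i \<in> I \<Longrightarrow> nonneg ev (f i)) \<Longrightarrow> nonneg ev (sum f I)"
  by (simp add: nonneg_def ev_sum sum_nonneg)

text \<open>
  Factoring out \<open>c\<close> leaves a forward Euler step with parameter \<open>dt tc / c\<close>, which (P1) covers as
  long as it is at most \<open>C\<close>. A vanishing \<open>c\<close> with \<open>tc > 0\<close> would force \<open>dt \<le> 0\<close>.
\<close>
lemma nonneg_euler_step:
  assumes fs: "function_space ev" and P1: "P1 ev T C" and C: "C > 0" and dt: "dt > 0"
    and "0 \<le> c" "0 \<le> tc" and le: "ereal dt \<le> c_sch * ereal C" "c_sch \<le> ratio c tc"
    and f: "nonneg ev f"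
  shows "nonneg ev (c *\<^sub>R f + tc *\<^sub>R dt *\<^sub>R T f)"
proof (cases "tc = 0")
  case True
  then show ?thesis using nonneg_scaleR[OF fs \<open>0 \<le> c\<close> f] by simp
next
  case False
  have "ereal dt \<le> ratio c tc * ereal C"
    using le C by (meson ereal_less(2) ereal_mult_right_mono less_imp_le order_trans)
  then have "dt \<le> c / tc * C" using False by (simp add: ratio_def)
  then have le: "tc * dt \<le> c * C" using False \<open>0 \<le> tc\<close> by (simp add: field_simps)
  moreover have "0 < tc * dt" using False \<open>0 \<le> tc\<close> dt by simp
  ultimately have "0 < c" using \<open>0 \<le> c\<close> C by (cases "c = 0") auto
  then have "nonneg ev (f + ((tc / c) * dt) *\<^sub>R T f)"
    using P1[unfolded P1_def, rule_format, OF f dt, of "tc / c"] le \<open>0 \<le> tc\<close> dt by (simp add: field_simps)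
  from nonneg_scaleR[OF fs \<open>0 \<le> c\<close> this] show ?thesis
    using \<open>0 < c\<close> by (simp add: scaleR_add_right)
qed

lemma nonneg_stages_A:
  assumes fs: "function_space ev" and P: "P1 ev T C" "P2 ev Q" and C: "C > 0" and dt: "dt > 0" "\<epsilon> > 0"
    and pos: "positivity_conditions_A \<nu> ta a"
    and le: "ereal dt \<le> c_sch_A \<nu> ta a * ereal C"
    and x0: "nonneg ev x0"
    and y: "\<And>i. i \<in> {1..\<nu>} \<Longrightarrow> y i = x0 + (\<Sum>j=1..<i. ta i j *\<^sub>R dt *\<^sub>R T (y j))
      + (\<Sum>j=1..i. a i j *\<^sub>R (dt / \<epsilon>) *\<^sub>R Q (y j))"
    and i: "i \<in> {1..\<nu>}"
  shows "nonneg ev (y i)"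
  using i
proof (induction i rule: less_induct)
  case (less i)
  let ?g = "c0_A a i *\<^sub>R x0 + (\<Sum>j=1..<i. c_coef a i j *\<^sub>R y j + tc_coef ta a i j *\<^sub>R dt *\<^sub>R T (y j))"
  have aii: "a j j > 0" if "j \<in> {1..\<nu>}" for j
    using pos that unfolding positivity_conditions_A_def by blast
  have "y i - (a i i * (dt / \<epsilon>)) *\<^sub>R Q (y i) = ?g"
  proof -
    have nz: "a j j \<noteq> 0" if "j \<in> {1..\<nu>}" for j using aii[OF that] by simp
    have "y i = c0_A a i *\<^sub>R x0 + (\<Sum>j=1..<i. c_coef a i j *\<^sub>R y j)
        + (\<Sum>j=1..<i. tc_coef ta a i j *\<^sub>R dt *\<^sub>R T (y j)) + a i i *\<^sub>R (dt / \<epsilon>) *\<^sub>R Q (y i)"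
      unfolding c0_A_def c_coef_def[symmetric]
      by (rule stage_shu_osher[OF _ y nz less.prems]) simp_all
    then have "y i - a i i *\<^sub>R (dt / \<epsilon>) *\<^sub>R Q (y i) = c0_A a i *\<^sub>R x0 + (\<Sum>j=1..<i. c_coef a i j *\<^sub>R y j)
        + (\<Sum>j=1..<i. tc_coef ta a i j *\<^sub>R dt *\<^sub>R T (y j))"
      unfolding diff_eq_eq .
    then show ?thesis by (simp add: sum.distrib)
  qed
  moreover have "nonneg ev ?g"
  proof (rule nonneg_add[OF fs], rule nonneg_scaleR[OF fs _ x0], goal_cases)
    case 1
    then show ?case using pos less.prems unfolding positivity_conditions_A_def by blast
  next
    case 2
    show ?case
    proof (rule nonneg_sum[OF fs])
      fix j assume j: "j \<in> {1..<i}"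
      then have ij: "i \<in> {2..\<nu>}" "j \<in> {1..i-1}" using less.prems by auto
      have c: "0 \<le> c_coef a i j" "0 \<le> tc_coef ta a i j"
        using pos ij unfolding positivity_conditions_A_def by blast+
      have sch: "c_sch_A \<nu> ta a \<le> ratio (c_coef a i j) (tc_coef ta a i j)"
        unfolding c_sch_A_def by (rule INF_lower2[OF ij(1)], rule INF_lower[OF ij(2)])
      show "nonneg ev (c_coef a i j *\<^sub>R y j + tc_coef ta a i j *\<^sub>R dt *\<^sub>R T (y j))"
        using j less by (intro nonneg_euler_step[OF fs P(1) C dt(1) c le sch]) auto
    qed
  qed
  moreover have "0 \<le> a i i * (dt / \<epsilon>)" using aii[OF less.prems] dt by simp
  ultimately show ?case using P(2) unfolding P2_def by blast
qed

text \<open>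
  The first column of \<open>a\<close> vanishes, hence the first stage is \<open>x0\<close> and its explicit term joins
  \<open>c0_ARS a i *\<^sub>R x0\<close> to form one more Euler step, with the coefficients \<open>c0_ARS\<close> and \<open>tc0_ARS\<close>.
\<close>
lemma nonneg_stages_ARS:
  assumes fs: "function_space ev" and P: "P1 ev T C" "P2 ev Q" and C: "C > 0" and dt: "dt > 0" "\<epsilon> > 0"
    and pos: "positivity_conditions_ARS \<nu> ta a"
    and col: "\<And>i. i \<in> {1..\<nu>} \<Longrightarrow> a i 1 = 0"
    and le: "ereal dt \<le> c_sch_ARS \<nu> ta a * ereal C"
    and x0: "nonneg ev x0"
    and y: "\<And>i. i \<in> {1..\<nu>} \<Longrightarrow> y i = x0 + (\<Sum>j=1..<i. ta i j *\<^sub>R dt *\<^sub>R T (y j))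
      + (\<Sum>j=1..i. a i j *\<^sub>R (dt / \<epsilon>) *\<^sub>R Q (y j))"
    and i: "i \<in> {1..\<nu>}"
  shows "nonneg ev (y i)"
  using i
proof (induction i rule: less_induct)
  case (less i)
  have y1: "y 1 = x0" using y[of 1] col[of 1] less.prems by simp
  show ?case
  proof (cases "i = 1")
    case True
    then show ?thesis using y1 x0 by simp
  next
    case False
    then have i2: "i \<in> {2..\<nu>}" using less.prems by auto
    let ?g = "(c0_ARS a i *\<^sub>R x0 + tc0_ARS ta a i *\<^sub>R dt *\<^sub>R T x0)
      + (\<Sum>j=2..<i. c_coef a i j *\<^sub>R y j + tc_coef ta a i j *\<^sub>R dt *\<^sub>R T (y j))"
    have aii: "a j j > 0" if "j \<in> {2..\<nu>}" for j
      using pos that unfolding positivity_conditions_ARS_def by blast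
    have y2: "y i = x0 + (\<Sum>j=1..<i. ta i j *\<^sub>R dt *\<^sub>R T (y j))
      + (\<Sum>j=2..i. a i j *\<^sub>R (dt / \<epsilon>) *\<^sub>R Q (y j))" if "i \<in> {2..\<nu>}" for i
    proof -
      have "{1..i} = insert 1 {2..i}" using that by auto
      then show ?thesis using y[of i] col[of i] that by simp
    qed
    \<comment> \<open>in column 1 the sum of \<open>tc_coef\<close> starts at \<open>1 + 1\<close>, the lower limit in \<open>tc0_ARS\<close>\<close>
    have tc1: "tc_coef ta a i 1 = tc0_ARS ta a i"
      by (simp add: tc_coef_def tc0_ARS_def numeral_2_eq_2)
    have split: "{1..<i} = insert 1 {2..<i}" using i2 by auto
    have "y i - (a i i * (dt / \<epsilon>)) *\<^sub>R Q (y i) = ?g"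
    proof -
      have nz: "a j j \<noteq> 0" if "j \<in> {2..\<nu>}" for j using aii[OF that] by simp
      have "y i = c0_ARS a i *\<^sub>R x0 + (\<Sum>j=2..<i. c_coef a i j *\<^sub>R y j)
          + (\<Sum>j=1..<i. tc_coef ta a i j *\<^sub>R dt *\<^sub>R T (y j)) + a i i *\<^sub>R (dt / \<epsilon>) *\<^sub>R Q (y i)"
        unfolding c0_ARS_def c_coef_def[symmetric]
        by (rule stage_shu_osher[OF _ y2 nz i2]) simp_all
      then have "y i - a i i *\<^sub>R (dt / \<epsilon>) *\<^sub>R Q (y i) = c0_ARS a i *\<^sub>R x0
          + (\<Sum>j=2..<i. c_coef a i j *\<^sub>R y j) + (\<Sum>j=1..<i. tc_coef ta a i j *\<^sub>R dt *\<^sub>R T (y j))"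
        unfolding diff_eq_eq .
      moreover have "(\<Sum>j=1..<i. tc_coef ta a i j *\<^sub>R dt *\<^sub>R T (y j)) = tc0_ARS ta a i *\<^sub>R dt *\<^sub>R T x0
          + (\<Sum>j=2..<i. tc_coef ta a i j *\<^sub>R dt *\<^sub>R T (y j))"
        unfolding split using tc1 y1 by simp
      ultimately show ?thesis by (simp add: sum.distrib)
    qed
    moreover have "nonneg ev ?g"
    proof (rule nonneg_add[OF fs], goal_cases)
      case 1
      have c: "0 \<le> c0_ARS a i" "0 \<le> tc0_ARS ta a i"
        using pos i2 unfolding positivity_conditions_ARS_def by blast+
      have "c_sch_ARS \<nu> ta a \<le> ratio (c0_ARS a i) (tc0_ARS ta a i)"
        unfolding c_sch_ARS_def by (rule min.coboundedI1, rule INF_lower[OF i2])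
      from nonneg_euler_step[OF fs P(1) C dt(1) c le this x0]
      show ?case .
    next
      case 2
      show ?case
      proof (rule nonneg_sum[OF fs])
        fix j assume j: "j \<in> {2..<i}"
        then have ij: "i \<in> {3..\<nu>}" "j \<in> {2..i-1}" using less.prems by auto
        have c: "0 \<le> c_coef a i j" "0 \<le> tc_coef ta a i j"
          using pos ij unfolding positivity_conditions_ARS_def by blast+
        have sch: "c_sch_ARS \<nu> ta a \<le> ratio (c_coef a i j) (tc_coef ta a i j)"
          unfolding c_sch_ARS_def by (rule min.coboundedI2, rule INF_lower2[OF ij(1)], rule INF_lower[OF ij(2)])
        show "nonneg ev (c_coef a i j *\<^sub>R y j + tc_coef ta a i j *\<^sub>R dt *\<^sub>R T (y j))"
          using j less by (intro nonneg_euler_step[OF fs P(1) C dt(1) c le sch]) auto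
      qed
    qed
    moreover have "0 \<le> a i i * (dt / \<epsilon>)" using aii[OF i2] dt by simp
    ultimately show ?thesis using P(2) unfolding P2_def by blast
  qed
qed

lemma imex_positivity_preserving:
  fixes ev :: "'v::real_normed_vector \<Rightarrow> 'x \<Rightarrow> real"
  assumes fs: "function_space ev" and C: "C > 0"
    and P: "P1 ev T C" "P2 ev Q" "P3 ev Q Q'" "P4 ev Q Q'"
    and gsa: "GSA \<nu> ta a tw w" and \<nu>: "\<nu> \<ge> 1" and tri: "imex_triangular \<nu> ta a"
    and type: "positivity_conditions_A \<nu> ta a \<and> c_sch = c_sch_A \<nu> ta a \<or>
         type_ARS \<nu> a w \<and> positivity_conditions_ARS \<nu> ta a \<and> c_sch = c_sch_ARS \<nu> ta a"
    and \<alpha>: "\<alpha> \<ge> 0"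
  shows "positivity_preserving ev T Q Q' \<nu> ta a tw w \<alpha> s (c_sch * ereal C)"
  unfolding positivity_preserving_def
proof (intro allI impI)
  fix \<epsilon> dt :: real and fn st ft f1
  assume \<epsilon>: "\<epsilon> > 0" and dt: "dt > 0" and le: "ereal dt \<le> c_sch * ereal C"
    and step: "imex_step T Q Q' \<nu> ta a tw w \<alpha> s \<epsilon> dt fn st ft f1" and fn: "nonneg ev fn"
  have st: "st i = fn + dt *\<^sub>R (\<Sum>j=1..<i. ta i j *\<^sub>R T (st j))
          + dt *\<^sub>R (\<Sum>j=1..i. a i j *\<^sub>R (1 / \<epsilon>) *\<^sub>R Q (st j))" if "i \<in> {1..\<nu>}" for i
    using step that unfolding imex_step_def by blast
  have y: "st i = fn + (\<Sum>j=1..<i. ta i j *\<^sub>R dt *\<^sub>R T (st j))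
      + (\<Sum>j=1..i. a i j *\<^sub>R (dt / \<epsilon>) *\<^sub>R Q (st j))" if "i \<in> {1..\<nu>}" for i
    by (subst st[OF that]) (simp add: scaleR_sum_right mult_ac)
  have last: "\<nu> \<in> {1..\<nu>}" using \<nu> by simp
  have "nonneg ev (st \<nu>)"
    using type
  proof
    assume "positivity_conditions_A \<nu> ta a \<and> c_sch = c_sch_A \<nu> ta a"
    then show ?thesis
      using nonneg_stages_A[OF fs P(1,2) C dt \<epsilon> _ _ fn y last] le by blast
  next
    assume "type_ARS \<nu> a w \<and> positivity_conditions_ARS \<nu> ta a \<and> c_sch = c_sch_ARS \<nu> ta a"
    then show ?thesis
      using nonneg_stages_ARS[OF fs P(1,2) C dt \<epsilon> _ _ _ fn y last] le unfolding type_ARS_def by blast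
  qed
  moreover have "ft = st \<nu>"
  proof -
    have w: "tw i = ta \<nu> i" "w i = a \<nu> i" if "i \<in> {1..\<nu>}" for i
      using gsa that unfolding GSA_def by auto
    have "{1..\<nu>} = insert \<nu> {1..<\<nu>}" using \<nu> by auto
    moreover have "ta \<nu> \<nu> = 0" using tri last unfolding imex_triangular_def by blast
    ultimately have "(\<Sum>i=1..\<nu>. tw i *\<^sub>R T (st i)) = (\<Sum>j=1..<\<nu>. ta \<nu> j *\<^sub>R T (st j))"
      using w by simp
    moreover have "(\<Sum>i=1..\<nu>. w i *\<^sub>R (1 / \<epsilon>) *\<^sub>R Q (st i)) = (\<Sum>i=1..\<nu>. a \<nu> i *\<^sub>R (1 / \<epsilon>) *\<^sub>R Q (st i))"
      using w by (intro sum.cong) auto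
    moreover have "ft = fn + dt *\<^sub>R (\<Sum>i=1..\<nu>. tw i *\<^sub>R T (st i))
        + dt *\<^sub>R (\<Sum>i=1..\<nu>. w i *\<^sub>R (1 / \<epsilon>) *\<^sub>R Q (st i))"
      using step unfolding imex_step_def by blast
    ultimately show ?thesis using st[OF last] by simp
  qed
  ultimately have ft: "nonneg ev ft" by simp
  define b where "b = \<alpha> * dt ^ 2 * (1 / \<epsilon> ^ 2)"
  have b: "0 \<le> b" using \<alpha> by (simp add: b_def)
  have f1: "f1 + b *\<^sub>R Q' (star_value s fn ft f1) (Q f1) = ft"
    using step unfolding imex_step_def b_def eq_diff_eq by blast
  show "nonneg ev f1"
  proof (cases s)
    case Star_Old
    then have "f1 + b *\<^sub>R Q' fn (Q f1) = ft" using f1 by simp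
    then show ?thesis using P(3)[unfolded P3_def] fn ft b by blast
  next
    case Star_Tilde
    then have "f1 + b *\<^sub>R Q' ft (Q f1) = ft" using f1 by simp
    then show ?thesis using P(3)[unfolded P3_def] ft b by blast
  next
    case Star_New
    then have "f1 + b *\<^sub>R Q' f1 (Q f1) = ft" using f1 by simp
    then show ?thesis using P(4)[unfolded P4_def] ft b by blast
  qed
qed

section \<open>Vector functions of order \<open>t ^ k\<close> at \<open>0\<close>\<close>

text \<open>
  Membership in \<open>O(t^k)\<close> as the step size \<open>t\<close> tends to \<open>0\<close> from the right. It is expressed through
  the norm because Landau symbols concern functions with values in a field.
\<close>
definition ord_ge :: "nat \<Rightarrow> (real \<Rightarrow> 'v::real_normed_vector) \<Rightarrow> bool" where
  "ord_ge k g \<longleftrightarrow> (\<lambda>t. norm (g t)) \<in> O[at_right 0](\<lambda>t. t ^ k)"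

lemma ord_ge_iff:
  "ord_ge k g \<longleftrightarrow> (\<exists>K\<ge>0. \<forall>\<^sub>F t in at_right 0. norm (g t) \<le> K * t ^ k)"
proof
  assume "ord_ge k g"
  then obtain K where K: "K > 0" "\<forall>\<^sub>F t in at_right (0::real). norm (g t) \<le> K * norm (t ^ k)"
    unfolding ord_ge_def by (elim landau_o.bigE) auto
  have "\<forall>\<^sub>F t in at_right 0. norm (g t) \<le> K * t ^ k"
    using K(2) eventually_at_right_less[of "0::real"] by eventually_elim simp
  then show "\<exists>K\<ge>0. \<forall>\<^sub>F t in at_right 0. norm (g t) \<le> K * t ^ k"
    using K(1) by (intro exI[of _ K]) auto
next
  assume "\<exists>K\<ge>0. \<forall>\<^sub>F t in at_right 0. norm (g t) \<le> K * t ^ k"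
  then obtain K where K: "\<forall>\<^sub>F t in at_right 0. norm (g t) \<le> K * t ^ k" by blast
  have "\<forall>\<^sub>F t in at_right 0. norm (norm (g t)) \<le> K * norm (t ^ k)"
    using K eventually_at_right_less[of "0::real"] by eventually_elim simp
  then show "ord_ge k g"
    unfolding ord_ge_def by (rule bigoI)
qed

text \<open>
  The scheme holds only for small positive step sizes, so its equations enter through this lemma.
\<close>
lemma ord_ge_cong:
  assumes "\<forall>\<^sub>F t in at_right 0. f t = g t" "ord_ge k f"
  shows "ord_ge k g"
proof -
  obtain K where K: "K \<ge> 0" "\<forall>\<^sub>F t in at_right 0. norm (f t) \<le> K * t ^ k"
    using assms(2) unfolding ord_ge_iff by blast
  show ?thesis
    unfolding ord_ge_iff using K(1) eventually_elim2[OF K(2) assms(1)] by auto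
qed

lemma ord_ge_mono:
  assumes "ord_ge k g" "l \<le> k"
  shows "ord_ge l g"
proof -
  obtain K where K: "K \<ge> 0" "\<forall>\<^sub>F t in at_right 0. norm (g t) \<le> K * t ^ k"
    using assms(1) unfolding ord_ge_iff by blast
  have "\<forall>\<^sub>F t in at_right (0::real). t < 1"
    by (rule eventually_at_right_real[of 0 1, THEN eventually_mono]) auto
  then have "\<forall>\<^sub>F t in at_right 0. norm (g t) \<le> K * t ^ l"
    using K(2) eventually_at_right_less[of "0::real"]
  proof eventually_elim
    case (elim t)
    have "t ^ k \<le> t ^ l" using elim assms(2) by (intro power_decreasing) auto
    then show ?case using elim(2) K(1) by (meson mult_left_mono order_trans)
  qed
  then show ?thesis unfolding ord_ge_iff using K(1) by blast
qed

lemma ord_ge_zero [simp]: "ord_ge k (\<lambda>t. 0)"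
  unfolding ord_ge_def by simp

lemma ord_ge_add:
  assumes "ord_ge k f" "ord_ge k g"
  shows "ord_ge k (\<lambda>t. f t + g t)"
proof -
  obtain K L where K: "K \<ge> 0" "\<forall>\<^sub>F t in at_right 0. norm (f t) \<le> K * t ^ k"
    and L: "L \<ge> 0" "\<forall>\<^sub>F t in at_right 0. norm (g t) \<le> L * t ^ k"
    using assms unfolding ord_ge_iff by blast
  have "\<forall>\<^sub>F t in at_right 0. norm (f t + g t) \<le> (K + L) * t ^ k"
    using K(2) L(2)
  proof eventually_elim
    case (elim t)
    then show ?case using norm_triangle_ineq[of "f t" "g t"] by (simp add: distrib_right)
  qed
  then show ?thesis unfolding ord_ge_iff using K(1) L(1) by (intro exI[of _ "K + L"]) auto
qed

lemma ord_ge_bilinear: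
  assumes "bounded_bilinear pr" "ord_ge k f" "ord_ge l g"
  shows "ord_ge (k + l) (\<lambda>t. pr (f t) (g t))"
proof -
  obtain K L where K: "K \<ge> 0" "\<forall>\<^sub>F t in at_right 0. norm (f t) \<le> K * t ^ k"
    and L: "L \<ge> 0" "\<forall>\<^sub>F t in at_right 0. norm (g t) \<le> L * t ^ l"
    using assms unfolding ord_ge_iff by blast
  obtain M where M: "M \<ge> 0" "\<And>x y. norm (pr x y) \<le> norm x * norm y * M"
    using bounded_bilinear.nonneg_bounded[OF assms(1)] by blast
  have "\<forall>\<^sub>F t in at_right 0. norm (pr (f t) (g t)) \<le> (K * L * M) * t ^ (k + l)"
    using K(2) L(2) eventually_at_right_less[of "0::real"]
  proof eventually_elim
    case (elim t)
    have "norm (pr (f t) (g t)) \<le> norm (f t) * norm (g t) * M" by (rule M)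
    also have "\<dots> \<le> (K * t ^ k) * (L * t ^ l) * M"
      using elim K(1) L(1) M(1) by (intro mult_right_mono mult_mono) auto
    finally show ?case by (simp add: power_add mult_ac)
  qed
  then show ?thesis unfolding ord_ge_iff using K(1) L(1) M(1)
    by (intro exI[of _ "K * L * M"]) auto
qed

lemma ord_ge_const [simp]: "ord_ge 0 (\<lambda>t. c)"
  unfolding ord_ge_def by simp

lemma ord_ge_blinfun:
  fixes A :: "'a::real_normed_vector \<Rightarrow>\<^sub>L 'b::real_normed_vector"
  assumes "ord_ge k g"
  shows "ord_ge k (\<lambda>t. A (g t))"
  using ord_ge_bilinear[OF bounded_bilinear_blinfun_apply ord_ge_const assms, of A] by simp

lemma ord_ge_scaleR:
  assumes "ord_ge k g"
  shows "ord_ge k (\<lambda>t. c *\<^sub>R g t)"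
  using ord_ge_bilinear[OF bounded_bilinear_scaleR ord_ge_const assms, of c] by simp

lemma ord_ge_power:
  assumes "ord_ge k g"
  shows "ord_ge (m + k) (\<lambda>t. t ^ m *\<^sub>R g t)"
proof -
  have "ord_ge m (\<lambda>t. t ^ m)" unfolding ord_ge_def by simp
  then show ?thesis by (rule ord_ge_bilinear[OF bounded_bilinear_scaleR _ assms])
qed

lemma ord_ge_shift: "ord_ge k g \<Longrightarrow> ord_ge (Suc k) (\<lambda>t. t *\<^sub>R g t)"
  using ord_ge_power[of k g 1] by simp

lemma ord_ge_diff:
  assumes "ord_ge k f" "ord_ge k g"
  shows "ord_ge k (\<lambda>t. f t - g t)"
  using ord_ge_add[OF assms(1) ord_ge_scaleR[OF assms(2), of "-1"]] by simp

lemma ord_ge_sum: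
  assumes "\<And>i. i \<in> I \<Longrightarrow> ord_ge k (f i)"
  shows "ord_ge k (\<lambda>t. \<Sum>i\<in>I. f i t)"
  using assms by (induction I rule: infinite_finite_induct) (auto intro: ord_ge_add)

lemma ord_ge_tendsto:
  assumes "ord_ge (Suc k) g"
  shows "(g \<longlongrightarrow> 0) (at_right 0)"
proof -
  obtain K where K: "\<forall>\<^sub>F t in at_right 0. norm (g t) \<le> K * t ^ 1"
    using ord_ge_mono[OF assms, of 1] unfolding ord_ge_iff by auto
  have "((\<lambda>t. K * t ^ 1) \<longlongrightarrow> K * 0 ^ 1) (at_right (0::real))"
    by (intro tendsto_intros)
  then show ?thesis using K by (intro Lim_null_comparison[of g "\<lambda>t. K * t ^ 1"]) auto
qed

lemma ord_ge_power_scaleR_imp_zero: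
  assumes "ord_ge (Suc k) (\<lambda>t. t ^ k *\<^sub>R c)"
  shows "c = 0"
proof -
  obtain K where K: "K \<ge> 0" "\<forall>\<^sub>F t in at_right 0. norm (t ^ k *\<^sub>R c) \<le> K * t ^ Suc k"
    using assms unfolding ord_ge_iff by blast
  have "\<forall>\<^sub>F t in at_right 0. norm c \<le> K * t ^ Suc 0"
    using K(2) eventually_at_right_less[of "0::real"]
  proof eventually_elim
    case (elim t)
    then have "t ^ k * norm c \<le> t ^ k * (K * t)" by (simp add: mult_ac)
    then show ?case using elim(2) by simp
  qed
  then have "ord_ge (Suc 0) (\<lambda>t. c)" unfolding ord_ge_iff using K(1) by blast
  then have "((\<lambda>t. c) \<longlongrightarrow> 0) (at_right (0::real))" by (rule ord_ge_tendsto)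
  then show ?thesis by (simp add: tendsto_const_iff)
qed

text \<open>
  The mean value inequality takes the place of an integral, since the space may be incomplete.
\<close>
lemma ord_ge_integrate:
  fixes g g' :: "real \<Rightarrow> 'v::real_normed_vector"
  assumes "h0 > 0" "g 0 = 0"
    and der: "\<And>t. t \<in> {0..h0} \<Longrightarrow> (g has_vector_derivative g' t) (at t within {0..h0})"
    and "ord_ge k g'"
  shows "ord_ge (Suc k) g"
proof -
  obtain K where K: "K \<ge> 0" "\<forall>\<^sub>F t in at_right 0. norm (g' t) \<le> K * t ^ k"
    using assms(4) unfolding ord_ge_iff by blast
  then obtain b where b: "b > 0" "\<And>t. 0 < t \<Longrightarrow> t < b \<Longrightarrow> norm (g' t) \<le> K * t ^ k"
    unfolding eventually_at_right_field by auto
  have bound: "norm (g t) \<le> K * t ^ Suc k" if t: "0 < t" "t < min b h0" for t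
  proof -
    have "norm (g t - g 0) \<le> (\<lambda>x. K * t ^ k * x) t - (\<lambda>x. K * t ^ k * x) 0"
    proof (rule differentiable_bound_general[where f' = g' and \<phi>' = "\<lambda>_. K * t ^ k"])
      show "continuous_on {0..t} g"
        using continuous_on_vector_derivative[OF der] t by (auto intro: continuous_on_subset)
      fix x assume x: "0 < x" "x < t"
      have "(g has_vector_derivative g' x) (at x within {0<..<h0})"
        using der[of x] x t by (auto intro: has_vector_derivative_within_subset)
      then show "(g has_vector_derivative g' x) (at x)"
        using x t at_within_open[of x "{0<..<h0}"] by auto
      show "((\<lambda>x. K * t ^ k * x) has_vector_derivative K * t ^ k) (at x)"
        by (auto intro!: derivative_eq_intros simp flip: has_real_derivative_iff_has_vector_derivative)
      have "x ^ k \<le> t ^ k" using x by (intro power_mono) auto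
      then show "norm (g' x) \<le> K * t ^ k"
        using b(2)[of x] x t K(1) by (auto intro: order_trans[OF _ mult_left_mono])
    qed (use t in \<open>auto intro!: continuous_intros\<close>)
    then show ?thesis using assms(2) by (simp add: mult_ac)
  qed
  have "\<forall>\<^sub>F t in at_right 0. norm (g t) \<le> K * t ^ Suc k"
    using eventually_at_right_real[of 0 "min b h0"] b(1) assms(1) bound
    by (auto elim!: eventually_mono)
  then show ?thesis unfolding ord_ge_iff using K(1) by blast
qed

section \<open>Second-order jets of smooth operators\<close>

text \<open>
  What the expansions of the exact solution and of the stages use of the smoothness of the
  operators. As a statement at one point it passes to \<open>T + L\<close>, the right-hand side of the
  differential equation, by adding the coefficients.
\<close>
definition taylor2 ::
  "('v::real_normed_vector \<Rightarrow> 'v) \<Rightarrow> 'v \<Rightarrow> ('v \<Rightarrow>\<^sub>L 'v) \<Rightarrow> ('v \<Rightarrow>\<^sub>L 'v \<Rightarrow>\<^sub>L 'v) \<Rightarrow> bool" where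
  "taylor2 F x0 A B \<longleftrightarrow>
    (\<lambda>h. norm (F (x0 + h) - (F x0 + A h + (1/2) *\<^sub>R B h h))) \<in> O[nhds 0](\<lambda>h. norm h ^ 3)"

lemma taylor2_add:
  assumes "taylor2 F x0 A B" "taylor2 G x0 A' B'"
  shows "taylor2 (\<lambda>x. F x + G x) x0 (A + A') (B + B')"
proof -
  let ?r = "\<lambda>F A B h. F (x0 + h) - (F x0 + blinfun_apply A h + (1/2) *\<^sub>R blinfun_apply (blinfun_apply B h) h)"
  have "(\<lambda>h. norm (?r F A B h) + norm (?r G A' B' h)) \<in> O[nhds 0](\<lambda>h. norm h ^ 3)"
    using assms unfolding taylor2_def by (rule sum_in_bigo)
  moreover have "(\<lambda>h. norm (?r (\<lambda>x. F x + G x) (A + A') (B + B') h))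
      \<in> O[nhds 0](\<lambda>h. norm (?r F A B h) + norm (?r G A' B' h))"
  proof (rule landau_o.big_mono, rule always_eventually, rule allI)
    fix h
    have eq: "?r (\<lambda>x. F x + G x) (A + A') (B + B') h = ?r F A B h + ?r G A' B' h"
      by (simp add: blinfun.bilinear_simps algebra_simps)
    show "norm (norm (?r (\<lambda>x. F x + G x) (A + A') (B + B') h))
        \<le> norm (norm (?r F A B h) + norm (?r G A' B' h))"
      unfolding eq real_norm_def abs_norm_cancel
      by (rule order_trans[OF norm_triangle_ineq abs_ge_self])
  qed
  ultimately show ?thesis unfolding taylor2_def by (rule landau_o.big_trans[rotated])
qed

lemma has_vector_derivative_along_line:
  assumes "(F has_derivative D) (at (p + t *\<^sub>R h))"
  shows "((\<lambda>s. F (p + s *\<^sub>R h)) has_vector_derivative D h) (at t)"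
proof -
  have "((\<lambda>s. p + s *\<^sub>R h) has_vector_derivative h) (at t)"
    by (auto intro!: derivative_eq_intros)
  from vector_derivative_diff_chain_within[OF this has_derivative_at_withinI[OF assms]]
  show ?thesis by (simp add: o_def)
qed

lemma has_vector_derivative_scaleR_const:
  fixes c :: "'v::real_normed_vector"
  assumes "(f has_real_derivative f') (at t)"
  shows "((\<lambda>t. f t *\<^sub>R c) has_vector_derivative f' *\<^sub>R c) (at t)"
  using bounded_linear.has_vector_derivative[OF bounded_linear_scaleR_left, of f f' "at t" c] assms
  by (simp add: has_real_derivative_iff_has_vector_derivative)

lemma unit_interval_bound:
  fixes g g' :: "real \<Rightarrow> 'v::real_normed_vector"
  assumes "\<And>t. t \<in> {0..1} \<Longrightarrow> (g has_vector_derivative g' t) (at t)"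
    and "\<And>t. t \<in> {0..1} \<Longrightarrow> norm (g' t) \<le> M"
  shows "norm (g 1 - g 0) \<le> M"
proof -
  have "norm (g 1 - g 0) \<le> (\<lambda>t. M * t) 1 - (\<lambda>t. M * t) 0"
  proof (rule differentiable_bound_general[where f' = g' and \<phi>' = "\<lambda>_. M"])
    show "continuous_on {0..1} g"
      using assms(1) by (intro continuous_on_vector_derivative) (auto intro: has_vector_derivative_at_within)
    show "((\<lambda>t. M * t) has_vector_derivative M) (at x)" for x
      by (auto intro!: derivative_eq_intros simp flip: has_real_derivative_iff_has_vector_derivative)
  qed (use assms in \<open>auto intro!: continuous_intros\<close>)
  then show ?thesis by simp
qed

text \<open>
  Continuity of the third derivative bounds it near \<open>x0\<close>. Two applications of the mean value
  inequality turn this bound into a Lipschitz estimate for the second derivative and a quadratic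
  one for the first.
\<close>
lemma C3_on_second_order_derivative:
  assumes "C3_on U F" "open U" "x0 \<in> U"
  obtains D B K r where "r > 0" "K \<ge> 0"
    "\<And>x. x \<in> ball x0 r \<Longrightarrow> (F has_derivative blinfun_apply (D x)) (at x)"
    "\<And>x. x \<in> ball x0 r \<Longrightarrow> norm (D x - (D x0 + blinfun_apply B (x - x0))) \<le> K * norm (x - x0) ^ 2"
proof -
  obtain D1 :: "'a \<Rightarrow> 'a \<Rightarrow>\<^sub>L 'a" and D2 :: "'a \<Rightarrow> 'a \<Rightarrow>\<^sub>L 'a \<Rightarrow>\<^sub>L 'a"
    and D3 :: "'a \<Rightarrow> 'a \<Rightarrow>\<^sub>L 'a \<Rightarrow>\<^sub>L 'a \<Rightarrow>\<^sub>L 'a"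
    where D1: "\<And>x. x \<in> U \<Longrightarrow> (F has_derivative blinfun_apply (D1 x)) (at x)"
      and D2: "\<And>x. x \<in> U \<Longrightarrow> (D1 has_derivative blinfun_apply (D2 x)) (at x)"
      and D3: "\<And>x. x \<in> U \<Longrightarrow> (D2 has_derivative blinfun_apply (D3 x)) (at x)"
      and cont: "continuous_on U D3"
    using assms(1) unfolding C3_on_def by blast
  define K where "K = norm (D3 x0) + 1"
  have "isCont D3 x0" using cont assms(2,3) by (simp add: continuous_on_eq_continuous_at)
  from this[unfolded continuous_at_eps_delta, THEN spec, of 1]
  obtain r1 where "r1 > 0 \<and> (\<forall>x. dist x x0 < r1 \<longrightarrow> dist (D3 x) (D3 x0) < 1)"
    by (elim impE exE conjE) (auto simp del: dist_norm)
  then have r1: "r1 > 0" "\<And>x. dist x x0 < r1 \<Longrightarrow> dist (D3 x) (D3 x0) < 1" by simp_all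
  obtain r2 where r2: "r2 > 0" "ball x0 r2 \<subseteq> U"
    using assms(2,3) openE by blast
  define r where "r = min r1 r2"
  have r: "r > 0" "ball x0 r \<subseteq> U" using r1 r2 by (auto simp: r_def)
  have K3: "norm (D3 x) \<le> K" if "x \<in> ball x0 r" for x
  proof -
    have "dist (D3 x) (D3 x0) < 1" using that r1(2)[of x] by (auto simp: r_def dist_commute)
    then show ?thesis unfolding K_def dist_norm
      using norm_triangle_ineq2[of "D3 x" "D3 x0"] by linarith
  qed
  have K2: "norm (D2 x - D2 x0) \<le> K * norm (x - x0)" if "x \<in> ball x0 r" for x
  proof (rule differentiable_bound[OF convex_ball[of x0 r], where f' = "\<lambda>x. blinfun_apply (D3 x)"])
    fix y assume y: "y \<in> ball x0 r"
    then have "y \<in> U" using r(2) by blast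
    then show "(D2 has_derivative blinfun_apply (D3 y)) (at y within ball x0 r)"
      by (rule has_derivative_at_withinI[OF D3])
    show "onorm (blinfun_apply (D3 y)) \<le> K"
      using K3[OF y] by (simp only: norm_blinfun.rep_eq)
  qed (use that r(1) in simp_all)
  have K1: "norm (D1 x - (D1 x0 + D2 x0 (x - x0))) \<le> K * norm (x - x0) ^ 2" if x: "x \<in> ball x0 r" for x
  proof -
    have seg: "closed_segment x0 x \<subseteq> ball x0 r"
      using x r(1) by (intro closed_segment_subset) auto
    have "norm (D1 x - D1 x0 - D2 x0 (x - x0)) \<le> norm (x - x0) * (K * norm (x - x0))"
    proof (rule differentiable_bound_linearization[where S = "closed_segment x0 x"
          and f' = "\<lambda>x. blinfun_apply (D2 x)"])
      show "x0 + t *\<^sub>R (x - x0) \<in> closed_segment x0 x" if "t \<in> {0..1}" for t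
        using that by (auto simp: in_segment algebra_simps intro!: exI[of _ t])
      fix y assume y: "y \<in> closed_segment x0 x"
      then have yb: "y \<in> ball x0 r" using seg by auto
      show "(D1 has_derivative blinfun_apply (D2 y)) (at y within closed_segment x0 x)"
        using yb r(2) by (intro has_derivative_at_withinI[OF D2]) blast
      have "norm (y - x0) \<le> norm (x - x0)"
        using segment_bound1[OF y] by (simp add: norm_minus_commute)
      then have "norm (D2 y - D2 x0) \<le> K * norm (x - x0)"
        by (intro order_trans[OF K2[OF yb] mult_left_mono]) (simp_all add: K_def)
      moreover have "blinfun_apply (D2 y) - blinfun_apply (D2 x0) = blinfun_apply (D2 y - D2 x0)"
        by (auto simp: blinfun.bilinear_simps)
      ultimately show "onorm (blinfun_apply (D2 y) - blinfun_apply (D2 x0)) \<le> K * norm (x - x0)"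
        by (simp add: norm_blinfun.rep_eq)
    qed auto
    then show ?thesis by (simp add: algebra_simps power2_eq_square)
  qed
  show thesis
  proof (rule that[of r K D1 "D2 x0"])
    show "(F has_derivative blinfun_apply (D1 x)) (at x)" if "x \<in> ball x0 r" for x
      using that r(2) by (intro D1) blast
  qed (use r K1 in \<open>simp_all add: K_def\<close>)
qed

text \<open>
  Both the Taylor formula and the symmetry follow from the quadratic estimate for the first
  derivative \<open>D\<close> by the mean value inequality on the unit interval. For the symmetry, the second
  difference \<open>F(x0 + sh + sk) - F(x0 + sh) - F(x0 + sk) + F(x0)\<close> equals \<open>s^2 B(h, k)\<close> up to
  \<open>O(s^3)\<close>; it does not change when \<open>h\<close> and \<open>k\<close> are exchanged, so \<open>B(h, k) - B(k, h)\<close> is \<open>O(s)\<close>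
  and hence zero.
\<close>
lemma C3_on_jet:
  assumes "C3_on U F" "open U" "x0 \<in> U"
  obtains D B where
    "\<forall>\<^sub>F x in nhds x0. (F has_derivative blinfun_apply (D x)) (at x)"
    "(\<lambda>h. norm (D (x0 + h) - (D x0 + blinfun_apply B h))) \<in> O[nhds 0](\<lambda>h. norm h ^ 2)"
    "taylor2 F x0 (D x0) B"
    "\<And>h k. B h k = B k h"
proof -
  obtain D B K r where r: "r > 0" and K0: "K \<ge> 0"
    and D: "\<And>x. x \<in> ball x0 r \<Longrightarrow> (F has_derivative blinfun_apply (D x)) (at x)"
    and K: "\<And>x. x \<in> ball x0 r \<Longrightarrow> norm (D x - (D x0 + blinfun_apply B (x - x0))) \<le> K * norm (x - x0) ^ 2"
    using C3_on_second_order_derivative[OF assms] by metis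
  have near: "\<forall>\<^sub>F h in nhds 0. norm (h::'a) < r"
    using eventually_nhds_in_open[of "ball 0 r" "0::'a"] r by simp
  have DB: "(\<lambda>h. norm (D (x0 + h) - (D x0 + blinfun_apply B h))) \<in> O[nhds 0](\<lambda>h. norm h ^ 2)"
    using near K[of "x0 + _"] by (intro bigoI[of _ K]) (auto elim!: eventually_mono simp: dist_norm)
  have "norm (F (x0 + h) - (F x0 + D x0 h + (1/2) *\<^sub>R B h h)) \<le> K * norm h ^ 3" if h: "norm h < r" for h
  proof -
    \<comment> \<open>restricting to the segment avoids differentiating the quadratic term in a varying direction, where the symmetry of \<open>B\<close> would be needed\<close>
    define g where "g t = F (x0 + t *\<^sub>R h) - (t *\<^sub>R D x0 h + (t^2 / 2) *\<^sub>R B h h)" for t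
    define g' where "g' t = (D (x0 + t *\<^sub>R h) - (D x0 + B (t *\<^sub>R h))) h" for t
    have "norm (g 1 - g 0) \<le> K * norm h ^ 3"
    proof (rule unit_interval_bound[of g g'])
      fix t :: real assume t: "t \<in> {0..1}"
      have th: "norm (t *\<^sub>R h) \<le> norm h" using t by (auto intro: mult_left_le_one_le)
      then have inb: "x0 + t *\<^sub>R h \<in> ball x0 r" using h by (simp add: dist_norm)
      show "(g has_vector_derivative g' t) (at t)"
        unfolding g_def
        by (rule has_vector_derivative_eq_rhs[OF has_vector_derivative_diff[OF
              has_vector_derivative_along_line[OF D[OF inb]]
              has_vector_derivative_add[OF has_vector_derivative_scaleR_const[of "\<lambda>t. t" 1]
                has_vector_derivative_scaleR_const[of "\<lambda>t. t^2 / 2" t]]]])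
          (auto intro!: derivative_eq_intros simp: g'_def blinfun.bilinear_simps)
      have "norm (g' t) \<le> norm (D (x0 + t *\<^sub>R h) - (D x0 + B (t *\<^sub>R h))) * norm h"
        unfolding g'_def by (rule norm_blinfun)
      also have "\<dots> \<le> (K * norm (t *\<^sub>R h) ^ 2) * norm h"
        using K[OF inb] by (intro mult_right_mono) auto
      also have "\<dots> \<le> (K * norm h ^ 2) * norm h"
        using th K0 by (intro mult_right_mono mult_left_mono power_mono) auto
      finally show "norm (g' t) \<le> K * norm h ^ 3" by (simp add: eval_nat_numeral mult_ac)
    qed
    then show ?thesis by (simp add: g_def algebra_simps)
  qed
  then have taylor: "taylor2 F x0 (D x0) B"
    unfolding taylor2_def using near by (intro bigoI[of _ K]) (auto elim!: eventually_mono)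
  define \<Delta> where "\<Delta> h k s = F (x0 + s *\<^sub>R h + s *\<^sub>R k) - F (x0 + s *\<^sub>R h) - F (x0 + s *\<^sub>R k) + F x0"
    for h k :: 'a and s :: real
  have second_diff: "ord_ge 3 (\<lambda>s. \<Delta> h k s - s^2 *\<^sub>R B h k)" for h k
  proof -
    define m where "m = norm h + norm k"
    have "norm (\<Delta> h k s - s^2 *\<^sub>R B h k) \<le> (2 * K * m ^ 2 * norm k) * s ^ 3"
      if s: "0 < s" "s * m < r" for s
    proof -
      define p where "p t = s *\<^sub>R h + t *\<^sub>R (s *\<^sub>R k)" for t
      define q where "q t = t *\<^sub>R (s *\<^sub>R k)" for t
      define g where "g t = F (x0 + s *\<^sub>R h + t *\<^sub>R (s *\<^sub>R k)) - F (x0 + t *\<^sub>R (s *\<^sub>R k)) - (t * s^2) *\<^sub>R B h k" for t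
      define g' where "g' t = (D (x0 + p t) - (D x0 + B (p t))) (s *\<^sub>R k)
          - (D (x0 + q t) - (D x0 + B (q t))) (s *\<^sub>R k)" for t
      have "norm (g 1 - g 0) \<le> (2 * K * m ^ 2 * norm k) * s ^ 3"
      proof (rule unit_interval_bound[of g g'])
        fix t :: real assume t: "t \<in> {0..1}"
        have tk: "norm (t *\<^sub>R (s *\<^sub>R k)) \<le> s * norm k"
          using t s mult_left_le_one_le[of "s * norm k" t] by simp
        have p: "norm (p t) \<le> s * m"
          using norm_triangle_ineq[of "s *\<^sub>R h" "t *\<^sub>R (s *\<^sub>R k)"] tk s(1)
          unfolding p_def m_def distrib_left by simp
        have q: "norm (q t) \<le> s * m"
          using tk s(1) unfolding q_def m_def distrib_left by (simp add: add_increasing)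
        have inb: "x0 + p t \<in> ball x0 r" "x0 + q t \<in> ball x0 r"
          using p q s by (auto simp: dist_norm)
        have Dp: "(F has_derivative blinfun_apply (D (x0 + p t))) (at (x0 + s *\<^sub>R h + t *\<^sub>R (s *\<^sub>R k)))"
          using D[OF inb(1)] by (simp add: p_def add.assoc)
        have Dq: "(F has_derivative blinfun_apply (D (x0 + q t))) (at (x0 + t *\<^sub>R (s *\<^sub>R k)))"
          using D[OF inb(2)] by (simp add: q_def)
        show "(g has_vector_derivative g' t) (at t)"
          unfolding g_def
          by (rule has_vector_derivative_eq_rhs[OF has_vector_derivative_diff[OF
                has_vector_derivative_diff[OF has_vector_derivative_along_line[OF Dp]
                  has_vector_derivative_along_line[OF Dq]]
                has_vector_derivative_scaleR_const[of "\<lambda>t. t * s^2" "s^2"]]])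
            (auto intro!: derivative_eq_intros
              simp: g'_def p_def q_def blinfun.bilinear_simps power2_eq_square algebra_simps)
        have bd: "norm ((D (x0 + y) - (D x0 + B y)) (s *\<^sub>R k)) \<le> K * m ^ 2 * norm k * s ^ 3"
          if y: "norm y \<le> s * m" "x0 + y \<in> ball x0 r" for y
        proof -
          have "norm ((D (x0 + y) - (D x0 + B y)) (s *\<^sub>R k)) \<le> norm (D (x0 + y) - (D x0 + B y)) * norm (s *\<^sub>R k)"
            by (rule norm_blinfun)
          also have "\<dots> \<le> (K * norm y ^ 2) * norm (s *\<^sub>R k)"
            using K[OF y(2)] by (intro mult_right_mono) auto
          also have "\<dots> \<le> (K * (s * m) ^ 2) * norm (s *\<^sub>R k)"
            using y(1) K0 by (intro mult_right_mono mult_left_mono power_mono) auto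
          finally show ?thesis using s by (simp add: eval_nat_numeral mult_ac)
        qed
        have "norm (g' t) \<le> K * m ^ 2 * norm k * s ^ 3 + K * m ^ 2 * norm k * s ^ 3"
          unfolding g'_def
          by (rule order_trans[OF norm_triangle_ineq4 add_mono[OF bd[OF p inb(1)] bd[OF q inb(2)]]])
        then show "norm (g' t) \<le> (2 * K * m ^ 2 * norm k) * s ^ 3" by (simp add: mult_ac)
      qed
      then show ?thesis by (simp add: g_def \<Delta>_def algebra_simps)
    qed
    moreover have "\<forall>\<^sub>F s in at_right 0. 0 < s \<and> s * m < r"
    proof -
      have "((\<lambda>s. s * m) \<longlongrightarrow> 0 * m) (at_right (0::real))" by (intro tendsto_intros)
      then have "\<forall>\<^sub>F s in at_right 0. s * m < r" using r by (auto dest: order_tendstoD(2))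
      then show ?thesis using eventually_at_right_less[of "0::real"] by eventually_elim simp
    qed
    ultimately have "\<forall>\<^sub>F s in at_right 0. norm (\<Delta> h k s - s^2 *\<^sub>R B h k) \<le> (2 * K * m ^ 2 * norm k) * s ^ 3"
      by (auto elim: eventually_mono)
    then show ?thesis unfolding ord_ge_iff using K0
      by (intro exI[of _ "2 * K * m ^ 2 * norm k"]) auto
  qed
  have sym: "B h k = B k h" for h k
  proof -
    have "\<Delta> h k s = \<Delta> k h s" for s by (simp add: \<Delta>_def algebra_simps)
    then have "ord_ge (Suc 2) (\<lambda>s. s^2 *\<^sub>R (B h k - B k h))"
      using ord_ge_diff[OF second_diff[of k h] second_diff[of h k]] by (simp add: algebra_simps)
    then show ?thesis using ord_ge_power_scaleR_imp_zero by fastforce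
  qed
  have "\<forall>\<^sub>F x in nhds x0. (F has_derivative blinfun_apply (D x)) (at x)"
    using eventually_nhds_in_open[of "ball x0 r" x0] r D by (auto elim: eventually_mono)
  then show thesis using that DB taylor sym by blast
qed

lemma C3_on_scaleR:
  assumes "C3_on U F"
  shows "C3_on U (\<lambda>x. c *\<^sub>R F x)"
proof -
  obtain D1 :: "'a \<Rightarrow> 'a \<Rightarrow>\<^sub>L 'a" and D2 :: "'a \<Rightarrow> 'a \<Rightarrow>\<^sub>L 'a \<Rightarrow>\<^sub>L 'a"
    and D3 :: "'a \<Rightarrow> 'a \<Rightarrow>\<^sub>L 'a \<Rightarrow>\<^sub>L 'a \<Rightarrow>\<^sub>L 'a"
    where D: "\<forall>x\<in>U. (F has_derivative blinfun_apply (D1 x)) (at x)"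
      "\<forall>x\<in>U. (D1 has_derivative blinfun_apply (D2 x)) (at x)"
      "\<forall>x\<in>U. (D2 has_derivative blinfun_apply (D3 x)) (at x)"
      "continuous_on U D3"
    using assms unfolding C3_on_def by blast
  have scale: "((\<lambda>x. c *\<^sub>R G x) has_derivative blinfun_apply (c *\<^sub>R G')) (at x)"
    if "(G has_derivative blinfun_apply G') (at x)"
    for G :: "'a \<Rightarrow> 'c::real_normed_vector" and G' x
    using has_derivative_scaleR_right[OF that, of c] by (simp add: scaleR_blinfun.rep_eq)
  show ?thesis
    unfolding C3_on_def
    by (rule exI[of _ "\<lambda>x. c *\<^sub>R D1 x"], rule exI[of _ "\<lambda>x. c *\<^sub>R D2 x"],
        rule exI[of _ "\<lambda>x. c *\<^sub>R D3 x"])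
      (use D in \<open>auto intro!: scale continuous_intros\<close>)
qed

text \<open>
  The directional derivatives required of \<open>Q'\<close> exist everywhere, but in the expansions the linear
  Frechet derivative is needed; near \<open>x0\<close> the two coincide by uniqueness of limits.
\<close>
lemma is_derivative_of_unique:
  assumes "is_derivative_of Q' Q" "(Q has_derivative D) (at g)"
  shows "Q' g f = D f"
proof -
  have "((\<lambda>s. Q (g + s *\<^sub>R f)) has_vector_derivative D f) (at 0)"
    using has_vector_derivative_along_line[of Q D g 0 f] assms(2) by simp
  then have "(\<lambda>\<delta>. norm (Q (g + \<delta> *\<^sub>R f) - Q g - \<delta> *\<^sub>R D f) / norm \<delta>) \<midarrow>0\<rightarrow> 0"
    unfolding has_vector_derivative_def has_derivative_at by simp
  moreover have norm_eq: "norm (Q (g + \<delta> *\<^sub>R f) - Q g - \<delta> *\<^sub>R D f) / norm \<delta>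
      = norm ((1 / \<delta>) *\<^sub>R (Q (g + \<delta> *\<^sub>R f) - Q g) - D f)" if "\<delta> \<noteq> 0" for \<delta> :: real
  proof -
    have "(1 / \<delta>) *\<^sub>R (Q (g + \<delta> *\<^sub>R f) - Q g) - D f = (1 / \<delta>) *\<^sub>R (Q (g + \<delta> *\<^sub>R f) - Q g - \<delta> *\<^sub>R D f)"
      using that by (simp add: scaleR_diff_right)
    then show ?thesis by (simp add: divide_inverse mult.commute)
  qed
  ultimately have "(\<lambda>\<delta>. norm ((1 / \<delta>) *\<^sub>R (Q (g + \<delta> *\<^sub>R f) - Q g) - D f)) \<midarrow>0\<rightarrow> 0"
    by (elim Lim_transform_eventually)
      (auto simp: eventually_at_filter norm_eq intro!: always_eventually)
  then have "(\<lambda>\<delta>. (1 / \<delta>) *\<^sub>R (Q (g + \<delta> *\<^sub>R f) - Q g)) \<midarrow>0\<rightarrow> D f"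
    by (simp add: tendsto_norm_zero_iff LIM_zero_iff)
  moreover have "(\<lambda>\<delta>. (1 / \<delta>) *\<^sub>R (Q (g + \<delta> *\<^sub>R f) - Q g)) \<midarrow>0\<rightarrow> Q' g f"
    using assms(1) unfolding is_derivative_of_def by blast
  ultimately show ?thesis by (metis LIM_unique)
qed

section \<open>Substituting expansions into jets\<close>

lemma taylor2_compose_remainder:
  assumes F: "taylor2 F x0 A B" and h: "ord_ge 1 h"
  shows "ord_ge 3 (\<lambda>t. F (x0 + h t) - (F x0 + A (h t) + (1/2) *\<^sub>R B (h t) (h t)))"
proof -
  have lim: "filterlim h (nhds 0) (at_right 0)" using ord_ge_tendsto[of 0 h] h by simp
  have "(\<lambda>t. norm (F (x0 + h t) - (F x0 + A (h t) + (1/2) *\<^sub>R B (h t) (h t))))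
      \<in> O[at_right 0](\<lambda>t. norm (h t) ^ 3)"
    using landau_o.big.compose[OF F[unfolded taylor2_def] lim] by simp
  moreover have "(\<lambda>t. norm (h t) ^ 3) \<in> O[at_right 0](\<lambda>t. (t ^ 1) ^ 3)"
    using h unfolding ord_ge_def by (rule landau_o.big_power)
  ultimately show ?thesis unfolding ord_ge_def by (auto intro: landau_o.big_trans)
qed

text \<open>
  The three composition lemmas take an expansion of the argument with remainder \<open>O(t^k)\<close> to one of
  the value with the same remainder, for \<open>k = 1, 2, 3\<close>: the three rounds of the bootstrap.
\<close>
lemma taylor2_compose0:
  assumes F: "taylor2 F x0 A B" and h: "ord_ge 1 h"
  shows "ord_ge 1 (\<lambda>t. F (x0 + h t) - F x0)"
proof -
  have "ord_ge 1 (\<lambda>t. (F (x0 + h t) - (F x0 + A (h t) + (1/2) *\<^sub>R B (h t) (h t)))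
      + (A (h t) + (1/2) *\<^sub>R B (h t) (h t)))"
    using taylor2_compose_remainder[OF assms]
      ord_ge_bilinear[OF bounded_bilinear_blinfun_apply ord_ge_blinfun[OF h, of B] h]
    by (intro ord_ge_add ord_ge_scaleR ord_ge_blinfun[OF h]) (auto elim!: ord_ge_mono)
  then show ?thesis by (simp add: algebra_simps)
qed

lemma ord_ge_of_expansion:
  assumes "ord_ge (Suc (Suc k)) (\<lambda>t. h t - t *\<^sub>R v t)" "ord_ge 0 v"
  shows "ord_ge 1 h"
proof -
  have "ord_ge 1 (\<lambda>t. (h t - t *\<^sub>R v t) + t *\<^sub>R v t)"
    using assms ord_ge_shift[OF assms(2)] by (intro ord_ge_add) (auto elim: ord_ge_mono)
  then show ?thesis by simp
qed

lemma taylor2_compose1: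
  assumes F: "taylor2 F x0 A B" and h: "ord_ge 2 (\<lambda>t. h t - t *\<^sub>R v)"
  shows "ord_ge 2 (\<lambda>t. F (x0 + h t) - (F x0 + t *\<^sub>R A v))"
proof -
  have h1: "ord_ge 1 h" using ord_ge_of_expansion[of 0 h "\<lambda>_. v"] h by (simp add: numeral_2_eq_2)
  have "ord_ge 2 (\<lambda>t. (F (x0 + h t) - (F x0 + A (h t) + (1/2) *\<^sub>R B (h t) (h t)))
      + A (h t - t *\<^sub>R v) + (1/2) *\<^sub>R B (h t) (h t))"
    using taylor2_compose_remainder[OF F h1] ord_ge_blinfun[OF h, of A]
      ord_ge_bilinear[OF bounded_bilinear_blinfun_apply ord_ge_blinfun[OF h1, of B] h1]
    by (intro ord_ge_add ord_ge_scaleR) (auto elim!: ord_ge_mono)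
  then show ?thesis by (simp add: algebra_simps blinfun.bilinear_simps)
qed

lemma taylor2_compose2:
  assumes F: "taylor2 F x0 A B" and h: "ord_ge 3 (\<lambda>t. h t - (t *\<^sub>R v + t^2 *\<^sub>R w))"
  shows "ord_ge 3 (\<lambda>t. F (x0 + h t) - (F x0 + t *\<^sub>R A v + t^2 *\<^sub>R (A w + (1/2) *\<^sub>R B v v)))"
proof -
  have "ord_ge 2 (\<lambda>t. (h t - (t *\<^sub>R v + t^2 *\<^sub>R w)) + t^2 *\<^sub>R w)"
    using ord_ge_power[OF ord_ge_const, of 2 w] by (intro ord_ge_add ord_ge_mono[OF h]) auto
  then have h2: "ord_ge 2 (\<lambda>t. h t - t *\<^sub>R v)" by (simp add: algebra_simps)
  have h1: "ord_ge 1 h" using ord_ge_of_expansion[of 0 h "\<lambda>_. v"] h2 by (simp add: numeral_2_eq_2)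
  have tv: "ord_ge 1 (\<lambda>t. t *\<^sub>R v)" using ord_ge_shift[OF ord_ge_const, of v] by simp
  have q1: "ord_ge 3 (\<lambda>t. B (h t - t *\<^sub>R v) (h t))"
    using ord_ge_bilinear[OF bounded_bilinear_blinfun_apply ord_ge_blinfun[OF h2, of B] h1] by simp
  have q2: "ord_ge 3 (\<lambda>t. B (t *\<^sub>R v) (h t - t *\<^sub>R v))"
    using ord_ge_bilinear[OF bounded_bilinear_blinfun_apply ord_ge_blinfun[OF tv, of B] h2] by (simp add: eval_nat_numeral)
  have "ord_ge 3 (\<lambda>t. (F (x0 + h t) - (F x0 + A (h t) + (1/2) *\<^sub>R B (h t) (h t)))
      + A (h t - (t *\<^sub>R v + t^2 *\<^sub>R w))
      + (1/2) *\<^sub>R (B (h t - t *\<^sub>R v) (h t) + B (t *\<^sub>R v) (h t - t *\<^sub>R v)))"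
    by (intro ord_ge_add ord_ge_scaleR taylor2_compose_remainder[OF F h1] ord_ge_blinfun[OF h] q1 q2)
  then show ?thesis
    by (simp add: algebra_simps blinfun.bilinear_simps power2_eq_square)
qed

lemma derivative_compose_remainder:
  fixes D :: "'v::real_normed_vector \<Rightarrow> 'w::real_normed_vector"
  assumes D: "(\<lambda>h. norm (D (x0 + h) - (D x0 + blinfun_apply B h))) \<in> O[nhds 0](\<lambda>h. norm h ^ 2)"
    and h: "ord_ge 1 h"
  shows "ord_ge 2 (\<lambda>t. D (x0 + h t) - (D x0 + B (h t)))"
proof -
  have lim: "filterlim h (nhds 0) (at_right 0)" using ord_ge_tendsto[of 0 h] h by simp
  have "(\<lambda>t. norm (D (x0 + h t) - (D x0 + B (h t)))) \<in> O[at_right 0](\<lambda>t. norm (h t) ^ 2)"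
    using landau_o.big.compose[OF D lim] by simp
  moreover have "(\<lambda>t. norm (h t) ^ 2) \<in> O[at_right 0](\<lambda>t. (t ^ 1) ^ 2)"
    using h unfolding ord_ge_def by (rule landau_o.big_power)
  ultimately show ?thesis
    unfolding ord_ge_def by (auto intro: landau_o.big_trans)
qed

lemma derivative_compose0:
  fixes D :: "'v::real_normed_vector \<Rightarrow> 'w::real_normed_vector"
  assumes D: "(\<lambda>h. norm (D (x0 + h) - (D x0 + blinfun_apply B h))) \<in> O[nhds 0](\<lambda>h. norm h ^ 2)"
    and h: "ord_ge 1 h"
  shows "ord_ge 1 (\<lambda>t. D (x0 + h t) - D x0)"
proof -
  have "ord_ge 1 (\<lambda>t. (D (x0 + h t) - (D x0 + B (h t))) + B (h t))"
    using ord_ge_mono[OF derivative_compose_remainder[OF assms], of 1]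
    by (intro ord_ge_add ord_ge_blinfun h) simp_all
  then show ?thesis by (simp add: algebra_simps)
qed

lemma derivative_compose1:
  fixes D :: "'v::real_normed_vector \<Rightarrow> 'w::real_normed_vector"
  assumes D: "(\<lambda>h. norm (D (x0 + h) - (D x0 + blinfun_apply B h))) \<in> O[nhds 0](\<lambda>h. norm h ^ 2)"
    and h: "ord_ge 2 (\<lambda>t. h t - t *\<^sub>R v)"
  shows "ord_ge 2 (\<lambda>t. D (x0 + h t) - (D x0 + t *\<^sub>R B v))"
proof -
  have h1: "ord_ge 1 h" using ord_ge_of_expansion[of 0 h "\<lambda>_. v"] h by (simp add: numeral_2_eq_2)
  from ord_ge_add[OF derivative_compose_remainder[OF D h1] ord_ge_blinfun[OF h, of B]]
  show ?thesis by (simp add: algebra_simps blinfun.bilinear_simps)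
qed

section \<open>Expansions of the exact solution, the stages and the correction\<close>

text \<open>
  Each round inserts the expansion of the solution found so far into the right-hand side of the
  differential equation and integrates, which gains one order. Continuity of the solution starts
  the process.
\<close>
lemma exact_solution_expansion:
  fixes v :: "real \<Rightarrow> 'v::real_normed_vector"
  assumes "h0 > 0"
    and ode: "\<And>t. t \<in> {0..h0} \<Longrightarrow> (v has_vector_derivative F (v t)) (at t within {0..h0})"
    and F: "taylor2 F (v 0) A B"
  shows "ord_ge 4 (\<lambda>t. v t - (v 0 + t *\<^sub>R F (v 0) + (t^2 / 2) *\<^sub>R A (F (v 0))
    + (t^3 / 6) *\<^sub>R (A (A (F (v 0))) + B (F (v 0)) (F (v 0)))))"
proof -
  define x0 where "x0 = v 0"
  define F0 where "F0 = F x0"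
  define h where "h t = v t - x0" for t
  have F': "taylor2 F x0 A B" using F by (simp add: x0_def)
  have vh: "v t = x0 + h t" for t by (simp add: h_def)
  have h0: "h 0 = 0" by (simp add: h_def x0_def)
  have der: "(h has_vector_derivative F (x0 + h t)) (at t within {0..h0})" if "t \<in> {0..h0}" for t
    using has_vector_derivative_diff[OF ode[OF that] has_vector_derivative_const[of x0]]
    by (simp add: h_def[abs_def])
  have poly: "((\<lambda>t. p t *\<^sub>R c) has_vector_derivative p' *\<^sub>R c) (at t within {0..h0})"
    if "(p has_real_derivative p') (at t)" for p p' t and c :: 'v
    using has_vector_derivative_at_within[OF has_vector_derivative_scaleR_const[OF that]] .
  have cont: "continuous_on {0..h0} h"
    by (rule continuous_on_vector_derivative[OF der])
  have "(h \<longlongrightarrow> 0) (at_right 0)"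
    using cont[unfolded continuous_on_def, rule_format, of 0] h0 assms(1)
    by (simp add: at_within_Icc_at_right)
  have hlim: "filterlim h (nhds 0) (at_right 0)" by fact
  \<comment> \<open>so far \<open>h\<close> only tends to \<open>0\<close>, while the composition lemmas need a rate: the bound comes directly from the Taylor formula\<close>
  have "ord_ge 0 (\<lambda>t. F (x0 + h t))"
  proof -
    have "ord_ge 0 h"
    proof -
      have "\<forall>\<^sub>F t in at_right 0. norm (h t) < 1"
        using order_tendstoD(2)[OF tendsto_norm_zero[OF hlim], of 1] by simp
      then show ?thesis unfolding ord_ge_iff by (intro exI[of _ 1]) (auto elim: eventually_mono)
    qed
    moreover have "ord_ge 0 (\<lambda>t. F (x0 + h t) - (F x0 + A (h t) + (1/2) *\<^sub>R B (h t) (h t)))"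
    proof -
      have "(\<lambda>t. norm (F (x0 + h t) - (F x0 + A (h t) + (1/2) *\<^sub>R B (h t) (h t))))
          \<in> O[at_right 0](\<lambda>t. norm (h t) ^ 3)"
        using landau_o.big.compose[OF F'[unfolded taylor2_def] hlim] by simp
      moreover have "(\<lambda>t. norm (h t) ^ 3) \<in> O[at_right 0](\<lambda>t. (t ^ 0) ^ 3)"
        using \<open>ord_ge 0 h\<close> unfolding ord_ge_def by (rule landau_o.big_power)
      ultimately show ?thesis unfolding ord_ge_def by (auto intro: landau_o.big_trans)
    qed
    moreover have "ord_ge 0 (\<lambda>t. B (h t) (h t))"
      using ord_ge_bilinear[OF bounded_bilinear_blinfun_apply ord_ge_blinfun[OF \<open>ord_ge 0 h\<close>, of B] \<open>ord_ge 0 h\<close>]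
      by simp
    ultimately have "ord_ge 0 (\<lambda>t. (F (x0 + h t) - (F x0 + A (h t) + (1/2) *\<^sub>R B (h t) (h t)))
        + (F x0 + A (h t) + (1/2) *\<^sub>R B (h t) (h t)))"
      by (intro ord_ge_add ord_ge_scaleR ord_ge_const) (auto intro: ord_ge_blinfun)
    then show ?thesis by simp
  qed
  from ord_ge_integrate[OF assms(1) h0 der this] have h1: "ord_ge 1 h" by simp
  have h2: "ord_ge 2 (\<lambda>t. h t - t *\<^sub>R F0)"
  proof -
    have "ord_ge (Suc 1) (\<lambda>t. h t - t *\<^sub>R F0)"
    proof (rule ord_ge_integrate[OF assms(1)])
      show "((\<lambda>t. h t - t *\<^sub>R F0) has_vector_derivative F (x0 + h t) - F0) (at t within {0..h0})"
        if "t \<in> {0..h0}" for t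
        using has_vector_derivative_diff[OF der[OF that] poly[of "\<lambda>t. t" 1 t F0]] by simp
    qed (use h0 taylor2_compose0[OF F' h1] in \<open>simp_all add: F0_def\<close>)
    then show ?thesis by (simp add: numeral_2_eq_2)
  qed
  have h3: "ord_ge 3 (\<lambda>t. h t - (t *\<^sub>R F0 + t^2 *\<^sub>R (1/2) *\<^sub>R A F0))"
  proof -
    have "ord_ge (Suc 2) (\<lambda>t. h t - (t *\<^sub>R F0 + t^2 *\<^sub>R (1/2) *\<^sub>R A F0))"
    proof (rule ord_ge_integrate[OF assms(1)])
      show "((\<lambda>t. h t - (t *\<^sub>R F0 + t^2 *\<^sub>R (1/2) *\<^sub>R A F0))
          has_vector_derivative F (x0 + h t) - (F0 + t *\<^sub>R A F0)) (at t within {0..h0})"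
        if "t \<in> {0..h0}" for t
        by (rule has_vector_derivative_eq_rhs[OF has_vector_derivative_diff[OF der[OF that]
                has_vector_derivative_add[OF poly[of "\<lambda>t. t" 1] poly[of "\<lambda>t. t^2" "2 * t"]]]])
          (auto intro!: derivative_eq_intros)
    qed (use h0 taylor2_compose1[OF F' h2] in \<open>simp_all add: F0_def\<close>)
    then show ?thesis by (simp add: eval_nat_numeral)
  qed
  have "ord_ge (Suc 3) (\<lambda>t. h t - (t *\<^sub>R F0 + ((t^2/2) *\<^sub>R A F0 + (t^3/6) *\<^sub>R (A (A F0) + B F0 F0))))"
  proof (rule ord_ge_integrate[OF assms(1)])
    show "((\<lambda>t. h t - (t *\<^sub>R F0 + ((t^2/2) *\<^sub>R A F0 + (t^3/6) *\<^sub>R (A (A F0) + B F0 F0))))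
        has_vector_derivative F (x0 + h t)
          - (F0 + t *\<^sub>R A F0 + t^2 *\<^sub>R (A ((1/2) *\<^sub>R A F0) + (1/2) *\<^sub>R B F0 F0))) (at t within {0..h0})"
      if "t \<in> {0..h0}" for t
      by (rule has_vector_derivative_eq_rhs[OF has_vector_derivative_diff[OF der[OF that]
              has_vector_derivative_add[OF poly[of "\<lambda>t. t" 1]
                has_vector_derivative_add[OF poly[of "\<lambda>t. t^2/2" t] poly[of "\<lambda>t. t^3/6" "t^2/2"]]]]])
        (auto intro!: derivative_eq_intros simp: blinfun.bilinear_simps scaleR_add_right)
  qed (use h0 taylor2_compose2[OF F' h3] in \<open>simp_all add: F0_def\<close>)
  then show ?thesis
    by (simp add: h_def F0_def x0_def eval_nat_numeral algebra_simps)
qed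

text \<open>
  The gain of one order in each round for the stages: errors of the operator values are multiplied
  by the step size.
\<close>
lemma ord_ge_combination:
  fixes \<beta> \<gamma> :: "nat \<Rightarrow> real"
  assumes "\<And>j. j \<in> I \<Longrightarrow> ord_ge k (\<lambda>t. f j t - p j t)"
    and "\<And>j. j \<in> I \<Longrightarrow> ord_ge k (\<lambda>t. g j t - q j t)"
  shows "ord_ge (Suc k) (\<lambda>t. t *\<^sub>R (\<Sum>j\<in>I. \<beta> j *\<^sub>R f j t + \<gamma> j *\<^sub>R g j t)
    - t *\<^sub>R (\<Sum>j\<in>I. \<beta> j *\<^sub>R p j t + \<gamma> j *\<^sub>R q j t))"
proof -
  have "ord_ge (Suc k) (\<lambda>t. t *\<^sub>R (\<Sum>j\<in>I. \<beta> j *\<^sub>R (f j t - p j t) + \<gamma> j *\<^sub>R (g j t - q j t)))"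
    by (intro ord_ge_shift ord_ge_sum ord_ge_add ord_ge_scaleR assms)
  then show ?thesis
    by (simp add: scaleR_diff_right sum_subtractf sum.distrib algebra_simps)
qed

text \<open>
  The implicit stages are known to be \<open>O(t)\<close>-close to \<open>x0\<close>; two rounds give
  \<open>st t i = x0 + t p i + t^2 q i + O(t^3)\<close>, and a third one gives the quadrature with the weights
  \<open>tw\<close>, \<open>w\<close>. The vectors \<open>T1 (q i)\<close> and \<open>T2 (p i) (p i)\<close> combine the elementary differentials
  of order three.
\<close>
lemma stage_expansions:
  fixes T L :: "'v::real_normed_vector \<Rightarrow> 'v" and st :: "real \<Rightarrow> nat \<Rightarrow> 'v"
  assumes T: "taylor2 T x0 T1 T2" and L: "taylor2 L x0 L1 L2"
    and st: "\<forall>\<^sub>F t in at_right 0. \<forall>i\<in>I.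
      st t i = x0 + t *\<^sub>R (\<Sum>j\<in>I. ta i j *\<^sub>R T (st t j) + a i j *\<^sub>R L (st t j))"
    and st1: "\<And>i. i \<in> I \<Longrightarrow> ord_ge 1 (\<lambda>t. st t i - x0)"
  defines "p \<equiv> \<lambda>i. \<Sum>j\<in>I. ta i j *\<^sub>R T x0 + a i j *\<^sub>R L x0"
  defines "q \<equiv> \<lambda>i. \<Sum>j\<in>I. ta i j *\<^sub>R T1 (p j) + a i j *\<^sub>R L1 (p j)"
  shows "ord_ge 4 (\<lambda>t. t *\<^sub>R (\<Sum>i\<in>I. tw i *\<^sub>R T (st t i) + w i *\<^sub>R L (st t i))
    - (t *\<^sub>R (\<Sum>i\<in>I. tw i *\<^sub>R T x0 + w i *\<^sub>R L x0)
      + t^2 *\<^sub>R (\<Sum>i\<in>I. tw i *\<^sub>R T1 (p i) + w i *\<^sub>R L1 (p i))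
      + t^3 *\<^sub>R (\<Sum>i\<in>I. tw i *\<^sub>R (T1 (q i) + (1/2) *\<^sub>R T2 (p i) (p i))
          + w i *\<^sub>R (L1 (q i) + (1/2) *\<^sub>R L2 (p i) (p i)))))"
proof -
  define h where "h i t = st t i - x0" for i t
  have sth: "st t i = x0 + h i t" for i t by (simp add: h_def)
  have h: "\<forall>\<^sub>F t in at_right 0.
      h i t = t *\<^sub>R (\<Sum>j\<in>I. ta i j *\<^sub>R T (x0 + h j t) + a i j *\<^sub>R L (x0 + h j t))" if "i \<in> I" for i
    using st
  proof eventually_elim
    case (elim t)
    have "h i t = t *\<^sub>R (\<Sum>j\<in>I. ta i j *\<^sub>R T (st t j) + a i j *\<^sub>R L (st t j))"
      unfolding h_def by (subst bspec[OF elim that]) (rule add_diff_cancel_left')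
    then show ?case by (simp only: sth)
  qed
  have h1: "ord_ge 1 (h i)" if "i \<in> I" for i using st1[OF that] by (simp add: h_def[abs_def])
  have h2: "ord_ge 2 (\<lambda>t. h i t - t *\<^sub>R p i)" if "i \<in> I" for i
  proof (rule ord_ge_cong)
    show "ord_ge 2 (\<lambda>t. t *\<^sub>R (\<Sum>j\<in>I. ta i j *\<^sub>R T (x0 + h j t) + a i j *\<^sub>R L (x0 + h j t))
        - t *\<^sub>R (\<Sum>j\<in>I. ta i j *\<^sub>R T x0 + a i j *\<^sub>R L x0))"
      using ord_ge_combination[OF taylor2_compose0[OF T h1] taylor2_compose0[OF L h1]]
      by (simp add: numeral_2_eq_2)
    show "\<forall>\<^sub>F t in at_right 0. t *\<^sub>R (\<Sum>j\<in>I. ta i j *\<^sub>R T (x0 + h j t) + a i j *\<^sub>R L (x0 + h j t))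
        - t *\<^sub>R (\<Sum>j\<in>I. ta i j *\<^sub>R T x0 + a i j *\<^sub>R L x0) = h i t - t *\<^sub>R p i"
      using h[OF that] by eventually_elim (simp only: p_def)
  qed
  have h3: "ord_ge 3 (\<lambda>t. h i t - (t *\<^sub>R p i + t^2 *\<^sub>R q i))" if "i \<in> I" for i
  proof (rule ord_ge_cong)
    show "ord_ge 3 (\<lambda>t. t *\<^sub>R (\<Sum>j\<in>I. ta i j *\<^sub>R T (x0 + h j t) + a i j *\<^sub>R L (x0 + h j t))
        - t *\<^sub>R (\<Sum>j\<in>I. ta i j *\<^sub>R (T x0 + t *\<^sub>R T1 (p j)) + a i j *\<^sub>R (L x0 + t *\<^sub>R L1 (p j))))"
      using ord_ge_combination[OF taylor2_compose1[OF T h2] taylor2_compose1[OF L h2]]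
      by (simp add: eval_nat_numeral)
    have pi: "p i = (\<Sum>j\<in>I. ta i j *\<^sub>R T x0 + a i j *\<^sub>R L x0)" by (simp only: p_def)
    have qi: "q i = (\<Sum>j\<in>I. ta i j *\<^sub>R T1 (p j) + a i j *\<^sub>R L1 (p j))" by (simp only: q_def)
    have eq: "t *\<^sub>R (\<Sum>j\<in>I. ta i j *\<^sub>R (T x0 + t *\<^sub>R T1 (p j)) + a i j *\<^sub>R (L x0 + t *\<^sub>R L1 (p j)))
        = t *\<^sub>R p i + t^2 *\<^sub>R q i" for t
      unfolding pi qi
      by (simp add: scaleR_add_right sum.distrib scaleR_sum_right power2_eq_square mult_ac)
    show "\<forall>\<^sub>F t in at_right 0. t *\<^sub>R (\<Sum>j\<in>I. ta i j *\<^sub>R T (x0 + h j t) + a i j *\<^sub>R L (x0 + h j t))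
        - t *\<^sub>R (\<Sum>j\<in>I. ta i j *\<^sub>R (T x0 + t *\<^sub>R T1 (p j)) + a i j *\<^sub>R (L x0 + t *\<^sub>R L1 (p j)))
        = h i t - (t *\<^sub>R p i + t^2 *\<^sub>R q i)"
      using h[OF that] by eventually_elim (simp only: eq)
  qed
  have "ord_ge 4 (\<lambda>t. t *\<^sub>R (\<Sum>i\<in>I. tw i *\<^sub>R T (x0 + h i t) + w i *\<^sub>R L (x0 + h i t))
      - t *\<^sub>R (\<Sum>i\<in>I. tw i *\<^sub>R (T x0 + t *\<^sub>R T1 (p i) + t^2 *\<^sub>R (T1 (q i) + (1/2) *\<^sub>R T2 (p i) (p i)))
        + w i *\<^sub>R (L x0 + t *\<^sub>R L1 (p i) + t^2 *\<^sub>R (L1 (q i) + (1/2) *\<^sub>R L2 (p i) (p i)))))"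
    using ord_ge_combination[OF taylor2_compose2[OF T h3] taylor2_compose2[OF L h3]]
    by (simp add: eval_nat_numeral)
  moreover have "t *\<^sub>R (\<Sum>i\<in>I. tw i *\<^sub>R (T x0 + t *\<^sub>R T1 (p i) + t^2 *\<^sub>R (T1 (q i) + (1/2) *\<^sub>R T2 (p i) (p i)))
        + w i *\<^sub>R (L x0 + t *\<^sub>R L1 (p i) + t^2 *\<^sub>R (L1 (q i) + (1/2) *\<^sub>R L2 (p i) (p i))))
    = t *\<^sub>R (\<Sum>i\<in>I. tw i *\<^sub>R T x0 + w i *\<^sub>R L x0)
      + t^2 *\<^sub>R (\<Sum>i\<in>I. tw i *\<^sub>R T1 (p i) + w i *\<^sub>R L1 (p i))
      + t^3 *\<^sub>R (\<Sum>i\<in>I. tw i *\<^sub>R (T1 (q i) + (1/2) *\<^sub>R T2 (p i) (p i))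
          + w i *\<^sub>R (L1 (q i) + (1/2) *\<^sub>R L2 (p i) (p i)))" for t
  proof -
    have t3: "t ^ 3 = t * t\<^sup>2" by (simp add: eval_nat_numeral)
    show ?thesis
      unfolding scaleR_sum_right sum.distrib[symmetric] t3
      by (intro sum.cong refl) (simp add: scaleR_add_right power2_eq_square mult_ac)
  qed
  ultimately show ?thesis unfolding sth by simp
qed

text \<open>
  Both factors need only be known up to \<open>O(t^2)\<close> because of the factor \<open>t^2\<close> in front. The direction
  \<open>v\<close> in which the base point \<open>f\<^sup>*\<close> moves is kept apart from the one of the argument: it vanishes for
  the old value, which is the only way the choice of \<open>f\<^sup>*\<close> influences the order conditions.
\<close>
lemma correction_expansion:
  assumes D: "(\<lambda>h. norm (D (x0 + h) - (D x0 + blinfun_apply L2 h))) \<in> O[nhds 0](\<lambda>h. norm h ^ 2)"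
    and L: "taylor2 L x0 (D x0) L2"
    and g: "ord_ge 2 (\<lambda>t. g t - (x0 + t *\<^sub>R v))"
    and f: "ord_ge 2 (\<lambda>t. f t - (x0 + t *\<^sub>R u))"
  shows "ord_ge 4 (\<lambda>t. t^2 *\<^sub>R blinfun_apply (D (g t)) (L (f t))
    - (t^2 *\<^sub>R D x0 (L x0) + t^3 *\<^sub>R (D x0 (D x0 u) + L2 v (L x0))))"
proof -
  have "ord_ge 2 (\<lambda>t. (g t - x0) - t *\<^sub>R v)" "ord_ge 2 (\<lambda>t. (f t - x0) - t *\<^sub>R u)"
    using f g by (simp_all add: algebra_simps)
  from derivative_compose1[OF D this(1)] taylor2_compose1[OF L this(2)]
  have Dg: "ord_ge 2 (\<lambda>t. D (g t) - (D x0 + t *\<^sub>R L2 v))"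
    and Lf: "ord_ge 2 (\<lambda>t. L (f t) - (L x0 + t *\<^sub>R D x0 u))" by simp_all
  have c: "ord_ge 0 (\<lambda>t. y + t *\<^sub>R z)" for y z :: "'b::real_normed_vector"
    using ord_ge_mono[OF ord_ge_shift[OF ord_ge_const], of 0 z] by (intro ord_ge_add) simp_all
  have Lf0: "ord_ge 0 (\<lambda>t. L (f t))"
    using ord_ge_add[OF ord_ge_mono[OF Lf, of 0] c[of "L x0" "D x0 u"]] by simp
  have "ord_ge 2 (\<lambda>t. (D (g t) - (D x0 + t *\<^sub>R L2 v)) (L (f t)))"
    using ord_ge_bilinear[OF bounded_bilinear_blinfun_apply Dg Lf0] by (simp add: numeral_2_eq_2)
  moreover have "ord_ge 2 (\<lambda>t. (D x0 + t *\<^sub>R L2 v) (L (f t) - (L x0 + t *\<^sub>R D x0 u)))"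
    using ord_ge_bilinear[OF bounded_bilinear_blinfun_apply c[of "D x0" "L2 v"] Lf] by (simp add: numeral_2_eq_2)
  moreover have "ord_ge 2 (\<lambda>t. t^2 *\<^sub>R L2 v (D x0 u))"
    using ord_ge_power[OF ord_ge_const, of 2 "L2 v (D x0 u)"] by (simp add: numeral_2_eq_2)
  ultimately have "ord_ge (2 + 2) (\<lambda>t. t^2 *\<^sub>R ((D (g t) - (D x0 + t *\<^sub>R L2 v)) (L (f t))
      + (D x0 + t *\<^sub>R L2 v) (L (f t) - (L x0 + t *\<^sub>R D x0 u)) + t^2 *\<^sub>R L2 v (D x0 u)))"
    by (intro ord_ge_power ord_ge_add)
  then show ?thesis
    by (simp add: blinfun.bilinear_simps algebra_simps power2_eq_square power3_eq_cube)
qed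

section \<open>The order conditions\<close>

lemma sum_linear_comb:
  fixes M :: "'a::real_normed_vector \<Rightarrow>\<^sub>L 'b::real_normed_vector"
  shows "(\<Sum>i\<in>I. w i *\<^sub>R M (tc i *\<^sub>R x + c i *\<^sub>R y))
    = (\<Sum>i\<in>I. w i * tc i) *\<^sub>R M x + (\<Sum>i\<in>I. w i * c i) *\<^sub>R M y"
  by (simp add: blinfun.bilinear_simps scaleR_add_right sum.distrib scaleR_sum_left)

lemma sum_nested_comb:
  fixes M A B :: "'v::real_normed_vector \<Rightarrow>\<^sub>L 'v"
  shows "(\<Sum>i\<in>I. w i *\<^sub>R M (\<Sum>j\<in>I. ta i j *\<^sub>R A (tc j *\<^sub>R x + c j *\<^sub>R y)
        + a i j *\<^sub>R B (tc j *\<^sub>R x + c j *\<^sub>R y)))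
    = (\<Sum>i\<in>I. \<Sum>j\<in>I. w i * ta i j * tc j) *\<^sub>R M (A x)
      + (\<Sum>i\<in>I. \<Sum>j\<in>I. w i * ta i j * c j) *\<^sub>R M (A y)
      + (\<Sum>i\<in>I. \<Sum>j\<in>I. w i * a i j * tc j) *\<^sub>R M (B x)
      + (\<Sum>i\<in>I. \<Sum>j\<in>I. w i * a i j * c j) *\<^sub>R M (B y)"
  by (simp add: blinfun.bilinear_simps blinfun.sum_right scaleR_add_right sum.distrib scaleR_sum_left
      scaleR_sum_right mult.assoc add.assoc)

lemma sum_quadratic_comb:
  fixes B :: "'v::real_normed_vector \<Rightarrow>\<^sub>L 'v \<Rightarrow>\<^sub>L 'v"
  assumes "B y x = B x y"
  shows "(\<Sum>i\<in>I. w i *\<^sub>R B (tc i *\<^sub>R x + c i *\<^sub>R y) (tc i *\<^sub>R x + c i *\<^sub>R y))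
    = (\<Sum>i\<in>I. w i * (tc i)^2) *\<^sub>R B x x + (2 * (\<Sum>i\<in>I. w i * tc i * c i)) *\<^sub>R B x y
      + (\<Sum>i\<in>I. w i * (c i)^2) *\<^sub>R B y y"
proof -
  have "w i *\<^sub>R B (tc i *\<^sub>R x + c i *\<^sub>R y) (tc i *\<^sub>R x + c i *\<^sub>R y)
      = (w i * (tc i)^2) *\<^sub>R B x x + (2 * (w i * tc i * c i)) *\<^sub>R B x y + (w i * (c i)^2) *\<^sub>R B y y" for i
  proof -
    have "w i *\<^sub>R B (tc i *\<^sub>R x + c i *\<^sub>R y) (tc i *\<^sub>R x + c i *\<^sub>R y)
      = (w i * (tc i)^2) *\<^sub>R B x x + (w i * tc i * c i) *\<^sub>R B x y + (w i * tc i * c i) *\<^sub>R B x y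
        + (w i * (c i)^2) *\<^sub>R B y y"
      by (simp add: blinfun.bilinear_simps assms scaleR_add_right power2_eq_square mult_ac)
    also have "\<dots> = (w i * (tc i)^2) *\<^sub>R B x x + (2 * (w i * tc i * c i)) *\<^sub>R B x y + (w i * (c i)^2) *\<^sub>R B y y"
      unfolding mult_2 scaleR_add_left by (simp only: add.assoc)
    finally show ?thesis .
  qed
  then show ?thesis
    by (simp only: sum.distrib sum_distrib_left scaleR_sum_left)
qed

lemma sum_triangular:
  fixes f g :: "nat \<Rightarrow> 'v::real_vector"
  assumes "imex_triangular \<nu> ta a" "i \<in> {1..\<nu>}"
  shows "(\<Sum>j=1..<i. ta i j *\<^sub>R f j) = (\<Sum>j=1..\<nu>. ta i j *\<^sub>R f j)"
    and "(\<Sum>j=1..i. a i j *\<^sub>R g j) = (\<Sum>j=1..\<nu>. a i j *\<^sub>R g j)"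
proof -
  have z: "ta i j = 0" if "j \<in> {1..\<nu>}" "j \<ge> i" for j
    using assms that unfolding imex_triangular_def by blast
  have z': "a i j = 0" if "j \<in> {1..\<nu>}" "j > i" for j
    using assms that unfolding imex_triangular_def by blast
  show "(\<Sum>j=1..<i. ta i j *\<^sub>R f j) = (\<Sum>j=1..\<nu>. ta i j *\<^sub>R f j)"
    using assms(2) z by (intro sum.mono_neutral_left) auto
  show "(\<Sum>j=1..i. a i j *\<^sub>R g j) = (\<Sum>j=1..\<nu>. a i j *\<^sub>R g j)"
    using assms(2) z' by (intro sum.mono_neutral_left) auto
qed

text \<open>
  The comparison of the coefficients of \<open>t\<close>, \<open>t^2\<close> and \<open>t^3\<close>. Expanding in the elementary
  differentials turns each sum over stages into a scalar prescribed by an order condition. The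
  shifts by \<open>\<alpha>\<close> in these conditions are the contributions of the correction to \<open>L1 L0\<close>,
  \<open>L1 (L1 T0)\<close> and \<open>L1 (L1 L0)\<close> and, when \<open>f\<^sup>*\<close> is not the old value, to \<open>L2 T0 L0\<close> and
  \<open>L2 L0 L0\<close>. The correction contains the mixed term only as \<open>L2 T0 L0\<close>, whereas Taylor's formula
  contains \<open>L2 T0 L0 + L2 L0 T0\<close>; a single condition can balance the two because \<open>L2\<close> is symmetric.
\<close>
lemma third_order_coefficients:
  fixes T1 L1 :: "'v::real_normed_vector \<Rightarrow>\<^sub>L 'v" and T2 L2 :: "'v \<Rightarrow>\<^sub>L 'v \<Rightarrow>\<^sub>L 'v" and T0 L0 :: 'v
  assumes tri: "imex_triangular \<nu> ta a"
    and ord: "order_conditions \<nu> ta a tw w \<alpha>"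
    and old: "s = Star_Old \<Longrightarrow> order_conditions_old \<nu> ta a tw w"
    and new: "s = Star_Tilde \<or> s = Star_New \<Longrightarrow> order_conditions_new \<nu> ta a tw w \<alpha>"
    and symT: "\<And>x y. T2 x y = T2 y x" and symL: "\<And>x y. L2 x y = L2 y x"
  defines "p \<equiv> \<lambda>i. \<Sum>j=1..\<nu>. ta i j *\<^sub>R T0 + a i j *\<^sub>R L0"
  defines "q \<equiv> \<lambda>i. \<Sum>j=1..\<nu>. ta i j *\<^sub>R T1 (p j) + a i j *\<^sub>R L1 (p j)"
  shows "(\<Sum>i=1..\<nu>. tw i *\<^sub>R T0 + w i *\<^sub>R L0) = T0 + L0"
    and "(\<Sum>i=1..\<nu>. tw i *\<^sub>R T1 (p i) + w i *\<^sub>R L1 (p i)) - \<alpha> *\<^sub>R L1 L0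
      = (1/2) *\<^sub>R (T1 + L1) (T0 + L0)"
    and "(\<Sum>i=1..\<nu>. tw i *\<^sub>R (T1 (q i) + (1/2) *\<^sub>R T2 (p i) (p i))
          + w i *\<^sub>R (L1 (q i) + (1/2) *\<^sub>R L2 (p i) (p i)))
        - \<alpha> *\<^sub>R (L1 (L1 (T0 + L0)) + L2 (if s = Star_Old then 0 else T0 + L0) L0)
      = (1/6) *\<^sub>R ((T1 + L1) ((T1 + L1) (T0 + L0)) + (T2 + L2) (T0 + L0) (T0 + L0))"
proof -
  let ?tc = "ex_abscissa ta" and ?c = "im_abscissa a"
  have p: "p i = ?tc i *\<^sub>R T0 + ?c i *\<^sub>R L0" if "i \<in> {1..\<nu>}" for i
    using sum_triangular[OF tri that, of "\<lambda>_. T0"] sum_triangular(2)[OF tri that, of "\<lambda>_. L0"]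
    by (simp add: p_def ex_abscissa_def im_abscissa_def sum.distrib scaleR_sum_left)
  have q: "q i = (\<Sum>j=1..\<nu>. ta i j *\<^sub>R T1 (?tc j *\<^sub>R T0 + ?c j *\<^sub>R L0)
      + a i j *\<^sub>R L1 (?tc j *\<^sub>R T0 + ?c j *\<^sub>R L0))" for i
    unfolding q_def by (intro sum.cong refl) (simp only: p)
  note o = ord[unfolded order_conditions_def Let_def]
  have first: "(\<Sum>i=1..\<nu>. tw i) = 1" "(\<Sum>i=1..\<nu>. w i) = 1" using o by blast+
  show "(\<Sum>i=1..\<nu>. tw i *\<^sub>R T0 + w i *\<^sub>R L0) = T0 + L0"
    unfolding sum.distrib scaleR_sum_left[symmetric] first by simp
  have second: "(\<Sum>i=1..\<nu>. tw i * ?tc i) = 1/2" "(\<Sum>i=1..\<nu>. tw i * ?c i) = 1/2"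
      "(\<Sum>i=1..\<nu>. w i * ?tc i) = 1/2" "(\<Sum>i=1..\<nu>. w i * ?c i) = 1/2 + \<alpha>"
    using o by (simp_all add: algebra_simps)
  have lin: "(\<Sum>i=1..\<nu>. u i *\<^sub>R M (p i))
      = (\<Sum>i=1..\<nu>. u i * ?tc i) *\<^sub>R M T0 + (\<Sum>i=1..\<nu>. u i * ?c i) *\<^sub>R M L0"
    for u and M :: "'v \<Rightarrow>\<^sub>L 'v"
    unfolding sum_linear_comb[symmetric] by (intro sum.cong refl) (simp only: p)
  show "(\<Sum>i=1..\<nu>. tw i *\<^sub>R T1 (p i) + w i *\<^sub>R L1 (p i)) - \<alpha> *\<^sub>R L1 L0
      = (1/2) *\<^sub>R (T1 + L1) (T0 + L0)"
    unfolding sum.distrib lin second by (simp add: blinfun.bilinear_simps algebra_simps)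
  have third: "(\<Sum>i=1..\<nu>. \<Sum>j=1..\<nu>. tw i * ta i j * ?tc j) = 1/6"
      "(\<Sum>i=1..\<nu>. \<Sum>j=1..\<nu>. tw i * ta i j * ?c j) = 1/6"
      "(\<Sum>i=1..\<nu>. \<Sum>j=1..\<nu>. tw i * a i j * ?tc j) = 1/6"
      "(\<Sum>i=1..\<nu>. \<Sum>j=1..\<nu>. tw i * a i j * ?c j) = 1/6"
      "(\<Sum>i=1..\<nu>. \<Sum>j=1..\<nu>. w i * ta i j * ?tc j) = 1/6"
      "(\<Sum>i=1..\<nu>. \<Sum>j=1..\<nu>. w i * ta i j * ?c j) = 1/6"
      "(\<Sum>i=1..\<nu>. \<Sum>j=1..\<nu>. w i * a i j * ?tc j) = 1/6 + \<alpha>"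
      "(\<Sum>i=1..\<nu>. \<Sum>j=1..\<nu>. w i * a i j * ?c j) = 1/6 + \<alpha>"
    using o by (simp_all only: diff_eq_eq)
  \<comment> \<open>\<open>\<sigma>\<close> merges the two sets of quadratic conditions\<close>
  define \<sigma> :: real where "\<sigma> = (if s = Star_Old then 0 else 1)"
  have quad: "(\<Sum>i=1..\<nu>. tw i * (?tc i)^2) = 1/3" "(\<Sum>i=1..\<nu>. tw i * ?tc i * ?c i) = 1/3"
      "(\<Sum>i=1..\<nu>. tw i * (?c i)^2) = 1/3" "(\<Sum>i=1..\<nu>. w i * (?tc i)^2) = 1/3"
      "(\<Sum>i=1..\<nu>. w i * ?tc i * ?c i) = 1/3 + \<sigma> * \<alpha>"
      "(\<Sum>i=1..\<nu>. w i * (?c i)^2) = 1/3 + 2 * (\<sigma> * \<alpha>)"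
    using old new unfolding order_conditions_old_def order_conditions_new_def Let_def \<sigma>_def diff_eq_eq
    by (cases s; simp)+
  have nest: "(\<Sum>i=1..\<nu>. u i *\<^sub>R M (q i))
      = (\<Sum>i=1..\<nu>. \<Sum>j=1..\<nu>. u i * ta i j * ?tc j) *\<^sub>R M (T1 T0)
      + (\<Sum>i=1..\<nu>. \<Sum>j=1..\<nu>. u i * ta i j * ?c j) *\<^sub>R M (T1 L0)
      + (\<Sum>i=1..\<nu>. \<Sum>j=1..\<nu>. u i * a i j * ?tc j) *\<^sub>R M (L1 T0)
      + (\<Sum>i=1..\<nu>. \<Sum>j=1..\<nu>. u i * a i j * ?c j) *\<^sub>R M (L1 L0)"
    for u and M :: "'v \<Rightarrow>\<^sub>L 'v"
    unfolding q by (rule sum_nested_comb)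
  have quadr: "(\<Sum>i=1..\<nu>. u i *\<^sub>R B (p i) (p i))
      = (\<Sum>i=1..\<nu>. u i * (?tc i)^2) *\<^sub>R B T0 T0 + (2 * (\<Sum>i=1..\<nu>. u i * ?tc i * ?c i)) *\<^sub>R B T0 L0
      + (\<Sum>i=1..\<nu>. u i * (?c i)^2) *\<^sub>R B L0 L0"
    if "\<And>x y. B x y = B y x" for u and B :: "'v \<Rightarrow>\<^sub>L 'v \<Rightarrow>\<^sub>L 'v"
    unfolding sum_quadratic_comb[OF that, symmetric] by (intro sum.cong refl) (simp only: p)
  have split: "(\<Sum>i=1..\<nu>. tw i *\<^sub>R (T1 (q i) + (1/2) *\<^sub>R T2 (p i) (p i))
          + w i *\<^sub>R (L1 (q i) + (1/2) *\<^sub>R L2 (p i) (p i)))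
      = ((\<Sum>i=1..\<nu>. tw i *\<^sub>R T1 (q i)) + (1/2) *\<^sub>R (\<Sum>i=1..\<nu>. tw i *\<^sub>R T2 (p i) (p i)))
        + ((\<Sum>i=1..\<nu>. w i *\<^sub>R L1 (q i)) + (1/2) *\<^sub>R (\<Sum>i=1..\<nu>. w i *\<^sub>R L2 (p i) (p i)))"
    by (simp add: scaleR_add_right sum.distrib scaleR_sum_right mult.commute)
  have star: "L2 (if s = Star_Old then 0 else T0 + L0) L0 = \<sigma> *\<^sub>R L2 T0 L0 + \<sigma> *\<^sub>R L2 L0 L0"
    by (simp add: \<sigma>_def blinfun.bilinear_simps)
  have cross: "B (T0 + L0) (T0 + L0) = B T0 T0 + 2 *\<^sub>R B T0 L0 + B L0 L0"
    if "\<And>x y. B x y = B y x" for B :: "'v \<Rightarrow>\<^sub>L 'v \<Rightarrow>\<^sub>L 'v"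
    using that[of L0 T0] by (simp add: blinfun.bilinear_simps scaleR_2)
  have crossTL: "(T2 + L2) (T0 + L0) (T0 + L0) = (T2 T0 T0 + 2 *\<^sub>R T2 T0 L0 + T2 L0 L0)
      + (L2 T0 T0 + 2 *\<^sub>R L2 T0 L0 + L2 L0 L0)"
    unfolding plus_blinfun.rep_eq cross[OF symT] cross[OF symL] ..
  show "(\<Sum>i=1..\<nu>. tw i *\<^sub>R (T1 (q i) + (1/2) *\<^sub>R T2 (p i) (p i))
          + w i *\<^sub>R (L1 (q i) + (1/2) *\<^sub>R L2 (p i) (p i)))
        - \<alpha> *\<^sub>R (L1 (L1 (T0 + L0)) + L2 (if s = Star_Old then 0 else T0 + L0) L0)
      = (1/6) *\<^sub>R ((T1 + L1) ((T1 + L1) (T0 + L0)) + (T2 + L2) (T0 + L0) (T0 + L0))"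
    unfolding split star crossTL nest quadr[OF symT] quadr[OF symL] third quad
    by (simp add: blinfun.bilinear_simps algebra_simps)
qed

section \<open>Third-order accuracy\<close>

text \<open>
  Since the equation for \<open>f1\<close> is implicit, its expansion is again bootstrapped: the closeness of
  \<open>f1\<close> to \<open>x0\<close> shows that the correction is \<open>O(t^2)\<close>, so \<open>f1\<close> has the linear term \<open>t F0\<close>, and with
  this the correction is known up to \<open>O(t^4)\<close>.
\<close>
lemma imex_step_expansion:
  fixes T L :: "'v::real_normed_vector \<Rightarrow> 'v" and st :: "real \<Rightarrow> nat \<Rightarrow> 'v"
  assumes tri: "imex_triangular \<nu> ta a"
    and ord: "order_conditions \<nu> ta a tw w \<alpha>"
    and old: "s = Star_Old \<Longrightarrow> order_conditions_old \<nu> ta a tw w"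
    and new: "s = Star_Tilde \<or> s = Star_New \<Longrightarrow> order_conditions_new \<nu> ta a tw w \<alpha>"
    and T: "taylor2 T x0 T1 T2" and L: "taylor2 L x0 (D x0) L2"
    and D: "(\<lambda>h. norm (D (x0 + h) - (D x0 + blinfun_apply L2 h))) \<in> O[nhds 0](\<lambda>h. norm h ^ 2)"
    and sym: "\<And>x y. T2 x y = T2 y x" "\<And>x y. L2 x y = L2 y x"
    and st: "\<forall>\<^sub>F t in at_right 0. \<forall>i\<in>{1..\<nu>}.
      st t i = x0 + t *\<^sub>R (\<Sum>j=1..\<nu>. ta i j *\<^sub>R T (st t j) + a i j *\<^sub>R L (st t j))"
    and ft: "\<forall>\<^sub>F t in at_right 0.
      ft t = x0 + t *\<^sub>R (\<Sum>i=1..\<nu>. tw i *\<^sub>R T (st t i) + w i *\<^sub>R L (st t i))"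
    and f1: "\<forall>\<^sub>F t in at_right 0.
      f1 t = ft t - \<alpha> *\<^sub>R t^2 *\<^sub>R D (star_value s x0 (ft t) (f1 t)) (L (f1 t))"
    and st1: "\<And>i. i \<in> {1..\<nu>} \<Longrightarrow> ord_ge 1 (\<lambda>t. st t i - x0)"
    and f11: "ord_ge 1 (\<lambda>t. f1 t - x0)"
  defines "F0 \<equiv> T x0 + L x0" and "A \<equiv> T1 + D x0" and "B \<equiv> T2 + L2"
  shows "ord_ge 4 (\<lambda>t. f1 t - (x0 + t *\<^sub>R F0 + (t^2 / 2) *\<^sub>R A F0
    + (t^3 / 6) *\<^sub>R (A (A F0) + B F0 F0)))"
proof -
  define p where "p i = (\<Sum>j=1..\<nu>. ta i j *\<^sub>R T x0 + a i j *\<^sub>R L x0)" for i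
  define q where "q i = (\<Sum>j=1..\<nu>. ta i j *\<^sub>R T1 (p j) + a i j *\<^sub>R D x0 (p j))" for i
  define c2 where "c2 = (\<Sum>i=1..\<nu>. tw i *\<^sub>R T1 (p i) + w i *\<^sub>R D x0 (p i))"
  define c3 where "c3 = (\<Sum>i=1..\<nu>. tw i *\<^sub>R (T1 (q i) + (1/2) *\<^sub>R T2 (p i) (p i))
          + w i *\<^sub>R (D x0 (q i) + (1/2) *\<^sub>R L2 (p i) (p i)))"
  define v where "v = (if s = Star_Old then 0 else F0)"
  define k3 where "k3 = D x0 (D x0 F0) + L2 v (L x0)"
  define S where "S t = t *\<^sub>R (\<Sum>i=1..\<nu>. tw i *\<^sub>R T (st t i) + w i *\<^sub>R L (st t i))" for t
  define g where "g t = star_value s x0 (ft t) (f1 t)" for t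
  define E where "E t = t^2 *\<^sub>R D (g t) (L (f1 t))" for t
  have coeff1: "(\<Sum>i=1..\<nu>. tw i *\<^sub>R T x0 + w i *\<^sub>R L x0) = F0"
    unfolding F0_def by (rule third_order_coefficients(1)[OF tri ord old new sym])
  have coeff2: "c2 - \<alpha> *\<^sub>R D x0 (L x0) = (1/2) *\<^sub>R A F0"
    unfolding c2_def p_def A_def F0_def
    by (rule third_order_coefficients(2)[OF tri ord old new sym])
  have coeff3: "c3 - \<alpha> *\<^sub>R k3 = (1/6) *\<^sub>R (A (A F0) + B F0 F0)"
    unfolding c3_def q_def p_def k3_def v_def A_def B_def F0_def
    by (rule third_order_coefficients(3)[OF tri ord old new sym])
  have "ord_ge 4 (\<lambda>t. S t - (t *\<^sub>R (\<Sum>i=1..\<nu>. tw i *\<^sub>R T x0 + w i *\<^sub>R L x0)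
      + t^2 *\<^sub>R c2 + t^3 *\<^sub>R c3))"
    unfolding S_def c2_def c3_def q_def p_def by (rule stage_expansions[OF T L st st1])
  then have S4: "ord_ge 4 (\<lambda>t. S t - (t *\<^sub>R F0 + t^2 *\<^sub>R c2 + t^3 *\<^sub>R c3))"
    unfolding coeff1 .
  have ft_eq: "\<forall>\<^sub>F t in at_right 0. ft t = x0 + S t"
    using ft by (simp add: S_def)
  have f1_eq: "\<forall>\<^sub>F t in at_right 0. f1 t = x0 + S t - \<alpha> *\<^sub>R E t"
    using f1 ft_eq by eventually_elim (simp only: E_def g_def)
  have ft2: "ord_ge 2 (\<lambda>t. ft t - (x0 + t *\<^sub>R F0))"
  proof (rule ord_ge_cong)
    show "ord_ge 2 (\<lambda>t. (S t - (t *\<^sub>R F0 + t^2 *\<^sub>R c2 + t^3 *\<^sub>R c3)) + (t^2 *\<^sub>R c2 + t^3 *\<^sub>R c3))"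
      using ord_ge_mono[OF S4, of 2] ord_ge_power[OF ord_ge_const, of 2 c2]
        ord_ge_mono[OF ord_ge_power[OF ord_ge_const, of 3 c3], of 2]
      by (intro ord_ge_add) simp_all
    show "\<forall>\<^sub>F t in at_right 0. (S t - (t *\<^sub>R F0 + t^2 *\<^sub>R c2 + t^3 *\<^sub>R c3)) + (t^2 *\<^sub>R c2 + t^3 *\<^sub>R c3)
        = ft t - (x0 + t *\<^sub>R F0)"
      using ft_eq by eventually_elim simp
  qed
  have tF0: "ord_ge 1 (\<lambda>t. t *\<^sub>R F0)" using ord_ge_shift[OF ord_ge_const, of F0] by simp
  have "ord_ge 1 (\<lambda>t. (ft t - (x0 + t *\<^sub>R F0)) + t *\<^sub>R F0)"
    using ord_ge_mono[OF ft2, of 1] by (intro ord_ge_add tF0) simp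
  then have ft1: "ord_ge 1 (\<lambda>t. ft t - x0)" by simp
  have g1: "ord_ge 1 (\<lambda>t. g t - x0)"
    using ft1 f11 by (cases s) (simp_all add: g_def)
  have E2: "ord_ge 2 E"
  proof -
    have "ord_ge 0 (\<lambda>t. (D (g t) - D x0) + D x0)"
      using ord_ge_mono[OF derivative_compose0[OF D g1], of 0] by (intro ord_ge_add) simp_all
    moreover have "ord_ge 0 (\<lambda>t. (L (f1 t) - L x0) + L x0)"
      using ord_ge_mono[OF taylor2_compose0[OF L f11], of 0] by (intro ord_ge_add) simp_all
    ultimately have "ord_ge (0 + 0) (\<lambda>t. D (g t) (L (f1 t)))"
      by (intro ord_ge_bilinear[OF bounded_bilinear_blinfun_apply]) simp_all
    from ord_ge_power[OF this, of 2] show ?thesis by (simp add: E_def[abs_def])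
  qed
  have f12: "ord_ge 2 (\<lambda>t. f1 t - (x0 + t *\<^sub>R F0))"
  proof (rule ord_ge_cong)
    show "ord_ge 2 (\<lambda>t. (ft t - (x0 + t *\<^sub>R F0)) - \<alpha> *\<^sub>R E t)"
      by (intro ord_ge_diff ft2 ord_ge_scaleR E2)
    show "\<forall>\<^sub>F t in at_right 0. (ft t - (x0 + t *\<^sub>R F0)) - \<alpha> *\<^sub>R E t = f1 t - (x0 + t *\<^sub>R F0)"
      using ft_eq f1_eq by eventually_elim simp
  qed
  have g2: "ord_ge 2 (\<lambda>t. g t - (x0 + t *\<^sub>R v))"
    using ft2 f12 by (cases s) (simp_all add: g_def v_def)
  have E4: "ord_ge 4 (\<lambda>t. E t - (t^2 *\<^sub>R D x0 (L x0) + t^3 *\<^sub>R k3))"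
    unfolding E_def k3_def by (rule correction_expansion[OF D L g2 f12])
  have poly: "(t *\<^sub>R F0 + t^2 *\<^sub>R c2 + t^3 *\<^sub>R c3) - \<alpha> *\<^sub>R (t^2 *\<^sub>R D x0 (L x0) + t^3 *\<^sub>R k3)
      = t *\<^sub>R F0 + (t^2 / 2) *\<^sub>R A F0 + (t^3 / 6) *\<^sub>R (A (A F0) + B F0 F0)" for t
  proof -
    have "(t *\<^sub>R F0 + t^2 *\<^sub>R c2 + t^3 *\<^sub>R c3) - \<alpha> *\<^sub>R (t^2 *\<^sub>R D x0 (L x0) + t^3 *\<^sub>R k3)
        = t *\<^sub>R F0 + t^2 *\<^sub>R (c2 - \<alpha> *\<^sub>R D x0 (L x0)) + t^3 *\<^sub>R (c3 - \<alpha> *\<^sub>R k3)"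
      by (simp add: algebra_simps)
    then show ?thesis unfolding coeff2 coeff3 by simp
  qed
  show ?thesis
  proof (rule ord_ge_cong)
    show "ord_ge 4 (\<lambda>t. (S t - (t *\<^sub>R F0 + t^2 *\<^sub>R c2 + t^3 *\<^sub>R c3))
        - \<alpha> *\<^sub>R (E t - (t^2 *\<^sub>R D x0 (L x0) + t^3 *\<^sub>R k3)))"
      by (intro ord_ge_diff S4 ord_ge_scaleR E4)
    have "(S t - (t *\<^sub>R F0 + t^2 *\<^sub>R c2 + t^3 *\<^sub>R c3)) - \<alpha> *\<^sub>R (E t - (t^2 *\<^sub>R D x0 (L x0) + t^3 *\<^sub>R k3))
        = (x0 + S t - \<alpha> *\<^sub>R E t) - (x0 + ((t *\<^sub>R F0 + t^2 *\<^sub>R c2 + t^3 *\<^sub>R c3)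
          - \<alpha> *\<^sub>R (t^2 *\<^sub>R D x0 (L x0) + t^3 *\<^sub>R k3)))" for t
      by (simp add: scaleR_diff_right)
    then have eq: "(S t - (t *\<^sub>R F0 + t^2 *\<^sub>R c2 + t^3 *\<^sub>R c3)) - \<alpha> *\<^sub>R (E t - (t^2 *\<^sub>R D x0 (L x0) + t^3 *\<^sub>R k3))
        = (x0 + S t - \<alpha> *\<^sub>R E t) - (x0 + t *\<^sub>R F0 + (t^2 / 2) *\<^sub>R A F0
        + (t^3 / 6) *\<^sub>R (A (A F0) + B F0 F0))" for t
      unfolding poly by (simp only: add.assoc)
    show "\<forall>\<^sub>F t in at_right 0. (S t - (t *\<^sub>R F0 + t^2 *\<^sub>R c2 + t^3 *\<^sub>R c3))
        - \<alpha> *\<^sub>R (E t - (t^2 *\<^sub>R D x0 (L x0) + t^3 *\<^sub>R k3))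
        = f1 t - (x0 + t *\<^sub>R F0 + (t^2 / 2) *\<^sub>R A F0 + (t^3 / 6) *\<^sub>R (A (A F0) + B F0 F0))"
      using f1_eq by eventually_elim (simp only: eq)
  qed
qed

text \<open>
  The factor \<open>1/\<epsilon>\<close> is absorbed into \<open>L\<close>, whose derivative is \<open>Q'/\<epsilon>\<close>; thus the factor \<open>1/\<epsilon>\<^sup>2\<close> of
  the correction disappears. The base point of the correction tends to \<open>x0\<close>, hence it lies for
  small steps where \<open>Q\<close> is smooth and \<open>Q'\<close> is the Frechet derivative.
\<close>
lemma imex_third_order_accurate:
  fixes T Q :: "'v::real_normed_vector \<Rightarrow> 'v"
  assumes der: "is_derivative_of Q' Q"
    and tri: "imex_triangular \<nu> ta a"
    and ord: "order_conditions \<nu> ta a tw w \<alpha>"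
    and old: "s = Star_Old \<Longrightarrow> order_conditions_old \<nu> ta a tw w"
    and new: "s = Star_Tilde \<or> s = Star_New \<Longrightarrow> order_conditions_new \<nu> ta a tw w \<alpha>"
  shows "third_order_accurate T Q Q' \<nu> ta a tw w \<alpha> s"
  unfolding third_order_accurate_def
proof (intro allI impI)
  fix \<epsilon> tn h0 :: real and u :: "real \<Rightarrow> 'v" and U :: "'v set"
    and st :: "real \<Rightarrow> nat \<Rightarrow> 'v" and ft f1 :: "real \<Rightarrow> 'v"
  assume \<epsilon>: "\<epsilon> > 0" and h0: "h0 > 0"
    and ode: "\<forall>t\<in>{tn..tn+h0}.
         (u has_vector_derivative (T (u t) + (1 / \<epsilon>) *\<^sub>R Q (u t))) (at t within {tn..tn+h0})"
    and U: "open U" "u tn \<in> U" and C3: "C3_on U T" "C3_on U Q"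
    and step: "\<forall>\<^sub>F dt in at_right 0.
         imex_step T Q Q' \<nu> ta a tw w \<alpha> s \<epsilon> dt (u tn) (st dt) (ft dt) (f1 dt)"
    and st1: "\<forall>i\<in>{1..\<nu>}. (\<lambda>dt. norm (st dt i - u tn)) \<in> O[at_right 0](\<lambda>dt. dt)"
    and f11: "(\<lambda>dt. norm (f1 dt - u tn)) \<in> O[at_right 0](\<lambda>dt. dt)"
  define x0 where "x0 = u tn"
  define v where "v t = u (tn + t)" for t
  define L where "L x = (1 / \<epsilon>) *\<^sub>R Q x" for x
  have v0: "v 0 = x0" by (simp add: v_def x0_def)
  obtain DT T2 where
    "\<forall>\<^sub>F x in nhds x0. (T has_derivative blinfun_apply (DT x)) (at x)"
    "(\<lambda>h. norm (DT (x0 + h) - (DT x0 + blinfun_apply T2 h))) \<in> O[nhds 0](\<lambda>h. norm h ^ 2)"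
    and DT: "taylor2 T x0 (DT x0) T2"
    and T2: "\<And>h k. blinfun_apply (blinfun_apply T2 h) k = T2 k h"
    by (rule C3_on_jet[OF C3(1) U, folded x0_def]) (rule that)
  have C3L: "C3_on U L" unfolding L_def[abs_def] by (rule C3_on_scaleR[OF C3(2)])
  obtain D L2 where
    D: "\<forall>\<^sub>F x in nhds x0. (L has_derivative blinfun_apply (D x)) (at x)"
    and DL2: "(\<lambda>h. norm (D (x0 + h) - (D x0 + blinfun_apply L2 h))) \<in> O[nhds 0](\<lambda>h. norm h ^ 2)"
    and L: "taylor2 L x0 (D x0) L2"
    and L2: "\<And>h k. blinfun_apply (blinfun_apply L2 h) k = L2 k h"
    by (rule C3_on_jet[OF C3L U, folded x0_def]) (rule that)
  have v_ode: "(v has_vector_derivative (\<lambda>x. T x + L x) (v t)) (at t within {0..h0})" if "t \<in> {0..h0}" for t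
  proof -
    have shift: "((+) tn has_vector_derivative 1) (at t within {0..h0})"
      by (auto intro!: derivative_eq_intros simp: has_vector_derivative_def)
    have "(u has_vector_derivative T (u (tn + t)) + L (u (tn + t))) (at (tn + t) within (+) tn ` {0..h0})"
    proof -
      have img: "(+) tn ` {0..h0} = {tn..tn+h0}"
        using image_add_atLeastAtMost[of tn 0 h0] by (simp add: add.commute)
      have "tn + t \<in> {tn..tn+h0}" using that by simp
      from bspec[OF ode this] show ?thesis unfolding img L_def .
    qed
    from vector_diff_chain_within[OF shift this] show ?thesis
      by (simp add: o_def v_def[abs_def])
  qed
  have exact: "ord_ge 4 (\<lambda>t. v t - (x0 + t *\<^sub>R (T x0 + L x0) + (t^2 / 2) *\<^sub>R (DT x0 + D x0) (T x0 + L x0)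
    + (t^3 / 6) *\<^sub>R ((DT x0 + D x0) ((DT x0 + D x0) (T x0 + L x0)) + (T2 + L2) (T x0 + L x0) (T x0 + L x0))))"
    using exact_solution_expansion[OF h0 v_ode, of "DT x0 + D x0" "T2 + L2"] taylor2_add[OF DT L]
    by (simp only: v0)
  have lin: "L x = (1 / \<epsilon>) *\<^sub>R Q x" for x by (simp add: L_def)
  have st': "\<forall>\<^sub>F t in at_right 0. \<forall>i\<in>{1..\<nu>}.
      st t i = x0 + t *\<^sub>R (\<Sum>j=1..\<nu>. ta i j *\<^sub>R T (st t j) + a i j *\<^sub>R L (st t j))"
    using step
  proof eventually_elim
    case (elim t)
    show ?case
    proof
      fix i assume i: "i \<in> {1..\<nu>}"
      have "st t i = x0 + t *\<^sub>R (\<Sum>j=1..<i. ta i j *\<^sub>R T (st t j)) + t *\<^sub>R (\<Sum>j=1..i. a i j *\<^sub>R L (st t j))"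
        using elim i unfolding imex_step_def x0_def lin by blast
      then show "st t i = x0 + t *\<^sub>R (\<Sum>j=1..\<nu>. ta i j *\<^sub>R T (st t j) + a i j *\<^sub>R L (st t j))"
        unfolding sum_triangular[OF tri i] sum.distrib scaleR_add_right add.assoc .
    qed
  qed
  have ft': "\<forall>\<^sub>F t in at_right 0.
      ft t = x0 + t *\<^sub>R (\<Sum>i=1..\<nu>. tw i *\<^sub>R T (st t i) + w i *\<^sub>R L (st t i))"
    using step
  proof eventually_elim
    case (elim t)
    have "ft t = x0 + t *\<^sub>R (\<Sum>i=1..\<nu>. tw i *\<^sub>R T (st t i)) + t *\<^sub>R (\<Sum>i=1..\<nu>. w i *\<^sub>R L (st t i))"
      using elim unfolding imex_step_def x0_def lin by blast
    then show ?case unfolding sum.distrib scaleR_add_right add.assoc .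
  qed
  have st1': "ord_ge 1 (\<lambda>t. st t i - x0)" if "i \<in> {1..\<nu>}" for i
    using st1 that by (simp add: ord_ge_def x0_def)
  have f11': "ord_ge 1 (\<lambda>t. f1 t - x0)"
    using f11 by (simp add: ord_ge_def x0_def)
  have ft1: "ord_ge 1 (\<lambda>t. ft t - x0)"
  proof (rule ord_ge_cong)
    have b: "ord_ge 0 (\<lambda>t. G (st t i))" if "i \<in> {1..\<nu>}" "taylor2 G x0 A B" for G i A B
    proof -
      have "ord_ge 0 (\<lambda>t. (G (x0 + (st t i - x0)) - G x0) + G x0)"
        using ord_ge_mono[OF taylor2_compose0[OF that(2) st1'[OF that(1)]], of 0]
        by (intro ord_ge_add) simp_all
      then show ?thesis by simp
    qed
    have "ord_ge 0 (\<lambda>t. \<Sum>i=1..\<nu>. tw i *\<^sub>R T (st t i) + w i *\<^sub>R L (st t i))"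
      by (intro ord_ge_sum ord_ge_add ord_ge_scaleR b[OF _ DT] b[OF _ L])
    from ord_ge_shift[OF this]
    show "ord_ge 1 (\<lambda>t. t *\<^sub>R (\<Sum>i=1..\<nu>. tw i *\<^sub>R T (st t i) + w i *\<^sub>R L (st t i)))" by simp
    show "\<forall>\<^sub>F t in at_right 0. t *\<^sub>R (\<Sum>i=1..\<nu>. tw i *\<^sub>R T (st t i) + w i *\<^sub>R L (st t i)) = ft t - x0"
      using ft' by eventually_elim simp
  qed
  have "ord_ge 1 (\<lambda>t. star_value s x0 (ft t) (f1 t) - x0)"
    using ft1 f11' by (cases s) simp_all
  then have "((\<lambda>t. star_value s x0 (ft t) (f1 t) - x0) \<longlongrightarrow> 0) (at_right 0)"
    using ord_ge_tendsto[of 0] by simp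
  then have "((\<lambda>t. star_value s x0 (ft t) (f1 t)) \<longlongrightarrow> x0) (at_right 0)"
    by (simp add: LIM_zero_iff)
  from eventually_compose_filterlim[OF D this]
  have near: "\<forall>\<^sub>F t in at_right 0. (L has_derivative blinfun_apply (D (star_value s x0 (ft t) (f1 t))))
      (at (star_value s x0 (ft t) (f1 t)))" .
  have derL: "is_derivative_of (\<lambda>g f. (1 / \<epsilon>) *\<^sub>R Q' g f) L"
    unfolding is_derivative_of_def
  proof (intro allI)
    fix g f
    have "((\<lambda>\<delta>. (1 / \<delta>) *\<^sub>R (Q (g + \<delta> *\<^sub>R f) - Q g)) \<longlongrightarrow> Q' g f) (at 0)"
      using der unfolding is_derivative_of_def by blast
    from tendsto_scaleR[OF tendsto_const[of "1 / \<epsilon>"] this]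
    show "((\<lambda>\<delta>. (1 / \<delta>) *\<^sub>R (L (g + \<delta> *\<^sub>R f) - L g)) \<longlongrightarrow> (1 / \<epsilon>) *\<^sub>R Q' g f) (at 0)"
      by (simp add: lin scaleR_diff_right mult.commute)
  qed
  have f1': "\<forall>\<^sub>F t in at_right 0.
      f1 t = ft t - \<alpha> *\<^sub>R t^2 *\<^sub>R D (star_value s x0 (ft t) (f1 t)) (L (f1 t))"
    using step near
  proof eventually_elim
    case (elim t)
    have "D (star_value s x0 (ft t) (f1 t)) (Q (f1 t)) = (1 / \<epsilon>) *\<^sub>R Q' (star_value s x0 (ft t) (f1 t)) (Q (f1 t))"
      using is_derivative_of_unique[OF derL elim(2)] by simp
    then have "\<alpha> *\<^sub>R t^2 *\<^sub>R D (star_value s x0 (ft t) (f1 t)) (L (f1 t))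
        = (\<alpha> * t ^ 2 * (1 / \<epsilon> ^ 2)) *\<^sub>R Q' (star_value s x0 (ft t) (f1 t)) (Q (f1 t))"
      by (simp add: lin blinfun.scaleR_right power2_eq_square)
    moreover have "f1 t = ft t - (\<alpha> * t ^ 2 * (1 / \<epsilon> ^ 2)) *\<^sub>R Q' (star_value s x0 (ft t) (f1 t)) (Q (f1 t))"
      using elim(1) unfolding imex_step_def x0_def by blast
    ultimately show ?case by (simp only:)
  qed
  have numeric: "ord_ge 4 (\<lambda>t. f1 t - (x0 + t *\<^sub>R (T x0 + L x0) + (t^2 / 2) *\<^sub>R (DT x0 + D x0) (T x0 + L x0)
    + (t^3 / 6) *\<^sub>R ((DT x0 + D x0) ((DT x0 + D x0) (T x0 + L x0)) + (T2 + L2) (T x0 + L x0) (T x0 + L x0))))"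
    by (rule imex_step_expansion[OF tri ord old new DT L DL2 T2 L2 st' ft' f1' st1' f11'])
  show "(\<lambda>dt. norm (f1 dt - u (tn + dt))) \<in> O[at_right 0](\<lambda>dt. dt ^ 4)"
    using ord_ge_diff[OF numeric exact] by (simp add: ord_ge_def v_def)
qed

theorem mainTheorem8:
  fixes ev :: "'v::real_normed_vector \<Rightarrow> 'x \<Rightarrow> real"
    and T Q :: "'v \<Rightarrow> 'v" and Q' :: "'v \<Rightarrow> 'v \<Rightarrow> 'v"
    and C \<alpha> :: real
    and \<nu> :: nat and ta a :: "nat \<Rightarrow> nat \<Rightarrow> real" and tw w :: "nat \<Rightarrow> real"
    and s :: star and c_sch :: ereal
  assumes "function_space ev"
    and "is_derivative_of Q' Q"
    and "C > 0"
    and "P1 ev T C"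
    and "P2 ev Q"
    and "P3 ev Q Q'"
    and "P4 ev Q Q'"
    and "imex_triangular \<nu> ta a"
    and "GSA \<nu> ta a tw w"
    and "type_A \<nu> a \<and> positivity_conditions_A \<nu> ta a \<and> c_sch = c_sch_A \<nu> ta a \<or>
         type_ARS \<nu> a w \<and> positivity_conditions_ARS \<nu> ta a \<and> c_sch = c_sch_ARS \<nu> ta a"
    and "\<alpha> \<ge> 0"
    and "order_conditions \<nu> ta a tw w \<alpha>"
    and "s = Star_Old \<Longrightarrow> order_conditions_old \<nu> ta a tw w"
    and "s = Star_Tilde \<or> s = Star_New \<Longrightarrow> order_conditions_new \<nu> ta a tw w \<alpha>"
  shows "third_order_accurate T Q Q' \<nu> ta a tw w \<alpha> s \<and>
         positivity_preserving ev T Q Q' \<nu> ta a tw w \<alpha> s (c_sch * ereal C)"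
proof
  show "third_order_accurate T Q Q' \<nu> ta a tw w \<alpha> s"
    using assms(2,8,12,13,14) by (rule imex_third_order_accurate)
  have "(\<Sum>i=1..\<nu>. tw i) = 1"
    using assms(12) unfolding order_conditions_def Let_def by blast
  then have "\<nu> \<noteq> 0" by (cases "\<nu> = 0") simp_all
  then show "positivity_preserving ev T Q Q' \<nu> ta a tw w \<alpha> s (c_sch * ereal C)"
    using assms(10) by (intro imex_positivity_preserving[OF assms(1,3-7,9) _ assms(8) _ assms(11)]) auto
qed

end
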